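(* Let $M$ be an $11$-dimensional (smooth, Riemannian) manifold, let $\nabla_0^{TM},\nabla_1^{TM}$ be two connections on $TM$, and let $\xi$ be a two-dimensional oriented Euclidean real vector bundle over $M$ with a Euclidean connection $\nabla^\xi$ and Euler form $c=e(\xi,\nabla^\xi)$. Put $A=\nabla_1^{TM}-\nabla_0^{TM}$, $\nabla_t^{TM}=(1-t)\nabla_0^{TM}+t\nabla_1^{TM}$, and let $R_t^{TM}$ be the curvature of $\nabla_t^{TM}$. Then $$\left\{\int_0^1\frac{\sqrt{2}\,\widehat{L}(TM,\nabla^{TM}_t)}{\cosh^2\frac{c}{2}}\,\mathrm{tr}\left[A\left(\frac{1}{2R_t^{TM}}-\frac{1}{4\pi\sin\frac{R^{TM}_t}{2\pi}}\right)\right]dt\right\}^{(11)}$$ $$=8\left\{\int_0^1\widehat{A}(TM,\nabla^{TM}_t)\cosh\left(\tfrac{c}{2}\right)\left(\mathrm{ch}(T_CM,\nabla^{T_CM}_t)-3(e^c+e^{-c}-2)\right)\mathrm{tr}\left[A\left(\frac{1}{2R_t^{TM}}-\frac{1}{8\pi\tan\frac{R^{TM}_t}{4\pi}}\right)\right]dt\right.$$ $$\left.+\int_0^1\widehat{A}(TM,\nabla^{TM}_t)\cosh\left(\tfrac{c}{2}\right)\mathrm{tr}\left[A\left(-\frac{1}{2\pi}\sin\frac{R^{TM}_t}{2\pi}-3\left(\frac{1}{2R_t^{TM}}-\frac{1}{8\pi\tan\frac{R^{TM}_t}{4\pi}}\right)\right)\right]dt\right\}^{(11)}.$$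
   Context: $\{\cdot\}^{(11)}$ denotes the degree $11$ component of a differential form. $T_CM=TM\otimes\mathbf C$, with connection $\nabla_t^{T_CM}$ induced by $\nabla_t^{TM}$. For a connection $\nabla$ with curvature $R$ on $TM$, $\widehat A(TM,\nabla)=\det^{1/2}\Big(\frac{\frac{\sqrt{-1}}{4\pi}R}{\sinh(\frac{\sqrt{-1}}{4\pi}R)}\Big)$, $\widehat L(TM,\nabla)=\det^{1/2}\Big(\frac{\frac{\sqrt{-1}}{2\pi}R}{\tanh(\frac{\sqrt{-1}}{4\pi}R)}\Big)$, and $\mathrm{ch}(E,\nabla^E)=\mathrm{tr}\exp\big(\frac{\sqrt{-1}}{2\pi}(\nabla^E)^2\big)$. Here $\det^{1/2}(f(R))=\exp(\frac12\mathrm{tr}\log f(R))$. The Euler form $c$ is normalized so that the Chern roots of $\xi\otimes\mathbf C$ are $\pm c$. Expressions such as $\frac{1}{2R}-\frac{1}{8\pi\tan(R/4\pi)}$ and $\frac1{2R}-\frac{1}{4\pi\sin(R/2\pi)}$ mean the power series in $z$ obtained from $\frac1{2z}-\frac1{8\pi\tan(z/4\pi)}$ and $\frac1{2z}-\frac1{4\pi\sin(z/2\pi)}$ (the singularity at $z=0$ is removable), evaluated at $z=R$. *)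

theory Defs
  imports "HOL-Analysis.Analysis" "HOL-Computational_Algebra.Formal_Laurent_Series"
begin

section \<open>The complex exterior algebra on the generators \<open>dx i\<close>\<close>

text \<open>
  An element is the family of its coefficients: the coefficient at \<open>S\<close>, where
  \<open>S = {i1 < \<dots> < ik}\<close>, belongs to the basis monomial \<open>dx i1 \<and> \<dots> \<and> dx ik\<close>.
\<close>

typedef 'n exterior = "UNIV :: ('n set \<Rightarrow> complex) set"
  morphisms coeff_at Ext by simp

lemma coeff_at_Ext [simp]: "coeff_at (Ext f) = f"
  by (simp add: Ext_inverse)

lemma exterior_eq_iff: "a = b \<longleftrightarrow> (\<forall>S. coeff_at a S = coeff_at b S)"
  by (metis coeff_at_inject ext)

text \<open>Reordering sign: \<open>dx T \<and> dx U = shuffle_sign T U dx (T \<union> U)\<close> for disjoint \<open>T\<close>, \<open>U\<close>.\<close>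

definition inversions :: "'n::linorder set \<Rightarrow> 'n set \<Rightarrow> ('n \<times> 'n) set" where
  "inversions T U = {(i, j). i \<in> T \<and> j \<in> U \<and> j < i}"

definition shuffle_sign :: "'n::linorder set \<Rightarrow> 'n set \<Rightarrow> complex" where
  "shuffle_sign T U = (-1) ^ card (inversions T U)"

lemma shuffle_sign_empty [simp]: "shuffle_sign {} U = 1" "shuffle_sign T {} = 1"
  by (simp_all add: shuffle_sign_def inversions_def)

lemma norm_shuffle_sign [simp]: "norm (shuffle_sign T U) = 1"
  by (simp add: shuffle_sign_def norm_power)

lemma shuffle_sign_Un_left:
  fixes T :: "'n::{finite,linorder} set"
  assumes "T \<inter> U = {}"
  shows "shuffle_sign (T \<union> U) V = shuffle_sign T V * shuffle_sign U V"
proof -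
  have "inversions (T \<union> U) V = inversions T V \<union> inversions U V"
    "inversions T V \<inter> inversions U V = {}"
    using assms by (auto simp: inversions_def)
  then show ?thesis
    by (simp add: shuffle_sign_def card_Un_disjoint power_add)
qed

lemma shuffle_sign_Un_right:
  fixes T :: "'n::{finite,linorder} set"
  assumes "U \<inter> V = {}"
  shows "shuffle_sign T (U \<union> V) = shuffle_sign T U * shuffle_sign T V"
proof -
  have "inversions T (U \<union> V) = inversions T U \<union> inversions T V"
    "inversions T U \<inter> inversions T V = {}"
    using assms by (auto simp: inversions_def)
  then show ?thesis
    by (simp add: shuffle_sign_def card_Un_disjoint power_add)
qed

instantiation exterior :: (type) real_vector
begin
definition "0 = Ext (\<lambda>S. 0)"
definition "a + b = Ext (\<lambda>S. coeff_at a S + coeff_at b S)"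
definition "- a = Ext (\<lambda>S. - coeff_at a S)"
definition "a - b = Ext (\<lambda>S. coeff_at a S - coeff_at b S)"
definition "r *\<^sub>R a = Ext (\<lambda>S. r *\<^sub>R coeff_at a S)"
instance
  by standard
    (simp_all add: exterior_eq_iff zero_exterior_def plus_exterior_def uminus_exterior_def
      minus_exterior_def scaleR_exterior_def algebra_simps)
end

lemma coeff_at_simps [simp]:
  "coeff_at 0 S = 0"
  "coeff_at (a + b) S = coeff_at a S + coeff_at b S"
  "coeff_at (- a) S = - coeff_at a S"
  "coeff_at (a - b) S = coeff_at a S - coeff_at b S"
  "coeff_at (r *\<^sub>R a) S = r *\<^sub>R coeff_at a S"
  by (simp_all add: zero_exterior_def plus_exterior_def uminus_exterior_def
      minus_exterior_def scaleR_exterior_def)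

instantiation exterior :: ("{finite,linorder}") real_algebra_1
begin

definition "1 = Ext (\<lambda>S. if S = {} then 1 else 0)"

definition times_exterior :: "'a exterior \<Rightarrow> 'a exterior \<Rightarrow> 'a exterior" where
  "a * b = Ext (\<lambda>S. \<Sum>T\<in>Pow S. shuffle_sign T (S - T) * coeff_at a T * coeff_at b (S - T))"

instance
proof
  fix a b c :: "'a exterior" and r :: real
  show "a * b * c = a * (b * c)"
    unfolding exterior_eq_iff
  proof
    fix S
    have "coeff_at (a * b * c) S =
      (\<Sum>T\<in>Pow S. \<Sum>U\<in>Pow T. shuffle_sign T (S - T) *
        (shuffle_sign U (T - U) * coeff_at a U * coeff_at b (T - U)) * coeff_at c (S - T))"
      by (simp add: times_exterior_def sum_distrib_left sum_distrib_right)
    also have "\<dots> = (\<Sum>(T, U)\<in>Sigma (Pow S) Pow. shuffle_sign T (S - T) *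
        (shuffle_sign U (T - U) * coeff_at a U * coeff_at b (T - U)) * coeff_at c (S - T))"
      by (rule sum.Sigma) auto
    also have "\<dots> = (\<Sum>(U, V)\<in>Sigma (Pow S) (\<lambda>U. Pow (S - U)). shuffle_sign U (S - U) *
        coeff_at a U * (shuffle_sign V (S - U - V) * coeff_at b V * coeff_at c (S - U - V)))"
    proof (rule sum.reindex_bij_witness[where j = "\<lambda>(T, U). (U, T - U)" and i = "\<lambda>(U, V). (U \<union> V, U)"])
      fix x :: "'a set \<times> 'a set"
      assume "x \<in> Sigma (Pow S) Pow"
      then obtain T U where x: "x = (T, U)" "T \<subseteq> S" "U \<subseteq> T" by auto
      have e: "S - U = (T - U) \<union> (S - T)" "S - U - (T - U) = S - T" "T = U \<union> (T - U)"
        using x by auto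
      have "shuffle_sign T (S - T) = shuffle_sign U (S - T) * shuffle_sign (T - U) (S - T)"
        by (subst e(3), rule shuffle_sign_Un_left) auto
      moreover have "shuffle_sign U (S - U) = shuffle_sign U (T - U) * shuffle_sign U (S - T)"
        by (subst e(1), rule shuffle_sign_Un_right) auto
      ultimately show "(case case x of (T, U) \<Rightarrow> (U, T - U) of (U, V) \<Rightarrow>
          shuffle_sign U (S - U) * coeff_at a U *
          (shuffle_sign V (S - U - V) * coeff_at b V * coeff_at c (S - U - V))) =
        (case x of (T, U) \<Rightarrow> shuffle_sign T (S - T) *
          (shuffle_sign U (T - U) * coeff_at a U * coeff_at b (T - U)) * coeff_at c (S - T))"
        using e(2) by (simp add: x(1))
    qed auto
    also have "\<dots> = (\<Sum>U\<in>Pow S. \<Sum>V\<in>Pow (S - U). shuffle_sign U (S - U) *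
        coeff_at a U * (shuffle_sign V (S - U - V) * coeff_at b V * coeff_at c (S - U - V)))"
      by (rule sum.Sigma[symmetric]) auto
    also have "\<dots> = coeff_at (a * (b * c)) S"
      by (simp add: times_exterior_def sum_distrib_left)
    finally show "coeff_at (a * b * c) S = coeff_at (a * (b * c)) S" .
  qed
  have if1: "(\<Sum>T\<in>Pow S. (if T = {} then f T else 0)) = f {}"
    for f :: "'a set \<Rightarrow> complex" and S
    by (simp add: sum.delta')
  have if2: "(\<Sum>T\<in>Pow S. (if S - T = {} then f T else 0)) = f S"
    for f :: "'a set \<Rightarrow> complex" and S
  proof -
    have "(\<Sum>T\<in>Pow S. (if S - T = {} then f T else 0)) = (\<Sum>T\<in>Pow S. (if T = S then f T else 0))"
      by (rule sum.cong) auto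
    then show ?thesis by (simp add: sum.delta')
  qed
  show "1 * a = a"
  proof -
    have "coeff_at (1 * a) S = coeff_at a S" for S
    proof -
      have "coeff_at (1 * a) S =
          (\<Sum>T\<in>Pow S. (if T = {} then shuffle_sign T (S - T) * coeff_at a (S - T) else 0))"
        unfolding times_exterior_def one_exterior_def coeff_at_Ext by (rule sum.cong) auto
      then show ?thesis by (simp only: if1) simp
    qed
    then show ?thesis by (simp add: exterior_eq_iff)
  qed
  show "a * 1 = a"
  proof -
    have "coeff_at (a * 1) S = coeff_at a S" for S
    proof -
      have "coeff_at (a * 1) S =
          (\<Sum>T\<in>Pow S. (if S - T = {} then shuffle_sign T (S - T) * coeff_at a T else 0))"
        unfolding times_exterior_def one_exterior_def coeff_at_Ext by (rule sum.cong) auto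
      then show ?thesis by (simp only: if2) simp
    qed
    then show ?thesis by (simp add: exterior_eq_iff)
  qed
  show "(a + b) * c = a * c + b * c" "a * (b + c) = a * b + a * c"
    by (simp_all add: exterior_eq_iff times_exterior_def algebra_simps sum.distrib)
  show "r *\<^sub>R a * b = r *\<^sub>R (a * b)" "a * r *\<^sub>R b = r *\<^sub>R (a * b)"
    by (simp_all add: exterior_eq_iff times_exterior_def scaleR_sum_right)
  show "(0 :: 'a exterior) \<noteq> 1"
  proof
    assume "(0 :: 'a exterior) = 1"
    then have "coeff_at (0 :: 'a exterior) {} = coeff_at 1 {}" by simp
    then show False by (simp add: one_exterior_def)
  qed
qed

end

text \<open>
  The norm is the sum of the absolute values of the coefficients. It is submultiplicative, so the
  exterior algebra is a Banach algebra and \<open>exp\<close>, \<open>cosh\<close>, \<open>suminf\<close> and \<open>integral\<close> apply to it.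
\<close>

instantiation exterior :: ("{finite,linorder}") real_normed_algebra_1
begin

definition norm_exterior_def: "norm a = (\<Sum>S\<in>UNIV. norm (coeff_at a S))"
definition dist_exterior_def: "dist a b = norm (a - b :: 'a exterior)"
definition sgn_exterior_def: "sgn a = inverse (norm a) *\<^sub>R (a :: 'a exterior)"
definition uniformity_exterior_def:
  "(uniformity :: ('a exterior \<times> 'a exterior) filter) = (INF e\<in>{0 <..}. principal {(x, y). dist x y < e})"
definition open_exterior_def:
  "open (U :: 'a exterior set) \<longleftrightarrow> (\<forall>x\<in>U. eventually (\<lambda>(x', y). x' = x \<longrightarrow> y \<in> U) uniformity)"

instance
proof
  fix a b :: "'a exterior" and r :: real
  show "norm a = 0 \<longleftrightarrow> a = 0"
    by (simp add: norm_exterior_def sum_nonneg_eq_0_iff exterior_eq_iff)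
  show "norm (a + b) \<le> norm a + norm b"
    by (simp add: norm_exterior_def sum.distrib[symmetric] sum_mono norm_triangle_ineq)
  show "norm (r *\<^sub>R a) = \<bar>r\<bar> * norm a"
    by (simp add: norm_exterior_def sum_distrib_left)
  show "norm (1 :: 'a exterior) = 1"
    by (simp add: norm_exterior_def one_exterior_def if_distrib[of norm] cong: if_cong)
  show "norm (a * b) \<le> norm a * norm b"
  proof -
    let ?f = "\<lambda>(T, U). norm (coeff_at a T) * norm (coeff_at b U)"
    have "norm (a * b) \<le> (\<Sum>S\<in>UNIV. \<Sum>T\<in>Pow S. norm (coeff_at a T) * norm (coeff_at b (S - T)))"
      unfolding norm_exterior_def times_exterior_def coeff_at_Ext
      by (intro sum_mono order.trans[OF norm_sum]) (simp add: norm_mult)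
    also have "\<dots> = (\<Sum>(S, T)\<in>Sigma UNIV Pow. norm (coeff_at a T) * norm (coeff_at b (S - T)))"
      by (rule sum.Sigma) auto
    also have "\<dots> = sum ?f ((\<lambda>(S, T). (T, S - T)) ` Sigma UNIV Pow)"
      by (subst sum.reindex) (auto simp: inj_on_def case_prod_unfold)
    also have "\<dots> \<le> sum ?f (UNIV \<times> UNIV)"
      by (rule sum_mono2) auto
    also have "\<dots> = norm a * norm b"
      by (simp add: norm_exterior_def sum_product sum.cartesian_product)
    finally show ?thesis .
  qed
qed (simp_all add: dist_exterior_def sgn_exterior_def uniformity_exterior_def open_exterior_def)

end

lemma norm_coeff_at_le: "norm (coeff_at a S) \<le> norm (a :: 'n::{finite,linorder} exterior)"
  unfolding norm_exterior_def by (rule member_le_sum) auto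

instance exterior :: ("{finite,linorder}") banach
proof
  fix X :: "nat \<Rightarrow> 'a exterior"
  assume X: "Cauchy X"
  have "Cauchy (\<lambda>n. coeff_at (X n) S)" for S
  proof (rule CauchyI)
    fix e :: real
    assume "0 < e"
    then obtain N where "\<forall>m\<ge>N. \<forall>n\<ge>N. norm (X m - X n) < e"
      using CauchyD[OF X] by blast
    then show "\<exists>N. \<forall>m\<ge>N. \<forall>n\<ge>N. norm (coeff_at (X m) S - coeff_at (X n) S) < e"
      by (metis coeff_at_simps(4) norm_coeff_at_le order.strict_trans1)
  qed
  then have "\<forall>S. \<exists>l. (\<lambda>n. coeff_at (X n) S) \<longlonglongrightarrow> l"
    using Cauchy_convergent_iff convergent_def by blast
  then obtain L where L: "\<And>S. (\<lambda>n. coeff_at (X n) S) \<longlonglongrightarrow> L S"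
    by metis
  have "(\<lambda>n. \<Sum>S\<in>UNIV. norm (coeff_at (X n) S - L S)) \<longlonglongrightarrow> (\<Sum>S\<in>(UNIV :: 'a set set). 0)"
    by (intro tendsto_sum tendsto_norm_zero) (use L LIM_zero in blast)
  then have "(\<lambda>n. norm (X n - Ext L)) \<longlonglongrightarrow> 0"
    by (simp add: norm_exterior_def)
  then have "X \<longlonglongrightarrow> Ext L"
    using LIM_zero_cancel tendsto_norm_zero_iff by blast
  then show "convergent X"
    by (auto simp: convergent_def)
qed

definition ext_const :: "complex \<Rightarrow> 'n exterior" where
  "ext_const z = Ext (\<lambda>S. if S = {} then z else 0)"

definition dx :: "'n \<Rightarrow> 'n exterior" where
  "dx i = Ext (\<lambda>S. if S = {i} then 1 else 0)"

definition degree_part :: "nat \<Rightarrow> 'n exterior \<Rightarrow> 'n exterior" where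
  "degree_part k a = Ext (\<lambda>S. if card S = k then coeff_at a S else 0)"

definition form1 :: "('n::{finite,linorder} \<Rightarrow> real) \<Rightarrow> 'n exterior" where
  "form1 \<alpha> = (\<Sum>a\<in>UNIV. \<alpha> a *\<^sub>R dx a)"

definition form2 :: "('n::{finite,linorder} \<Rightarrow> 'n \<Rightarrow> real) \<Rightarrow> 'n exterior" where
  "form2 \<beta> = (1/2) *\<^sub>R (\<Sum>a\<in>UNIV. \<Sum>b\<in>UNIV. \<beta> a b *\<^sub>R (dx a * dx b))"


section \<open>Power series evaluated at forms and at matrices of forms\<close>

primrec matrix_power :: "'a::semiring_1^'k^'k \<Rightarrow> nat \<Rightarrow> 'a^'k^'k" where
  "matrix_power B 0 = mat 1"
| "matrix_power B (Suc k) = B ** matrix_power B k"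

definition fps_form :: "complex fps \<Rightarrow> 'n::{finite,linorder} exterior \<Rightarrow> 'n exterior" where
  "fps_form f x = (\<Sum>k. ext_const (fps_nth f k) * x ^ k)"

definition fps_matrix ::
  "complex fps \<Rightarrow> 'n::{finite,linorder} exterior^'k^'k \<Rightarrow> 'n exterior^'k^'k" where
  "fps_matrix f B = (\<Sum>k. \<chi> i j. ext_const (fps_nth f k) * matrix_power B k $ i $ j)"

text \<open>
  The logarithm of a power series \<open>f\<close> with nonzero constant term:
  \<open>log f = log f(0) + log (1 + (f / f(0) - 1))\<close>; \<open>fps_ln 1\<close> is the series of \<open>log (1 + z)\<close>.
\<close>

definition fps_log :: "complex fps \<Rightarrow> complex fps" where
  "fps_log f = fps_const (ln (fps_nth f 0)) +
     fps_compose (fps_ln 1) (f / fps_const (fps_nth f 0) - 1)"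

definition sqrt_det ::
  "complex fps \<Rightarrow> 'n::{finite,linorder} exterior^'k^'k \<Rightarrow> 'n exterior" where
  "sqrt_det f R = exp (trace (fps_matrix (fps_log f) R) /\<^sub>R 2)"

text \<open>The power series of \<open>sinh (w z)\<close> and \<open>cosh (w z)\<close> in \<open>z\<close>.\<close>

definition fps_sinh :: "complex \<Rightarrow> complex fps" where
  "fps_sinh w = (fps_exp w - fps_exp (- w)) / 2"

definition fps_cosh :: "complex \<Rightarrow> complex fps" where
  "fps_cosh w = (fps_exp w + fps_exp (- w)) / 2"

definition A_hat :: "'n::{finite,linorder} exterior^'k^'k \<Rightarrow> 'n exterior" where
  "A_hat R = sqrt_det (fps_const (\<i> / (4 * pi)) * fps_X / fps_sinh (\<i> / (4 * pi))) R"

definition L_hat :: "'n::{finite,linorder} exterior^'k^'k \<Rightarrow> 'n exterior" where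
  "L_hat R = sqrt_det
     (fps_const (\<i> / (2 * pi)) * fps_X / (fps_sinh (\<i> / (4 * pi)) / fps_cosh (\<i> / (4 * pi)))) R"

definition chern_character :: "'n::{finite,linorder} exterior^'k^'k \<Rightarrow> 'n exterior" where
  "chern_character R = trace (fps_matrix (fps_exp (\<i> / (2 * pi))) R)"

text \<open>
  The power series of \<open>1/(2z) - 1/(8 pi tan (z/4pi))\<close> and \<open>1/(2z) - 1/(4 pi sin (z/2pi))\<close>. The poles
  at \<open>0\<close> cancel, so the regular part of the Laurent series is the whole series.
\<close>

definition tan_series :: "complex fps" where
  "tan_series = fls_regpart
     (inverse (2 * fls_X) - inverse (fls_const (8 * pi) * fps_to_fls (fps_tan (1 / (4 * pi)))))"

definition sin_series :: "complex fps" where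
  "sin_series = fls_regpart
     (inverse (2 * fls_X) - inverse (fls_const (4 * pi) * fps_to_fls (fps_sin (1 / (2 * pi)))))"


section \<open>Smooth manifolds and tangent vectors\<close>

primrec differentiable_times ::
  "nat \<Rightarrow> 'a::real_normed_vector set \<Rightarrow> ('a \<Rightarrow> 'b::real_normed_vector) \<Rightarrow> bool" where
  "differentiable_times 0 S f \<longleftrightarrow> continuous_on S f"
| "differentiable_times (Suc n) S f \<longleftrightarrow>
     (\<forall>x\<in>S. f differentiable (at x)) \<and>
     (\<forall>v. differentiable_times n S (\<lambda>x. frechet_derivative f (at x) v))"

text \<open>Used for open \<open>S\<close> only.\<close>

definition smooth_on ::
  "'a::real_normed_vector set \<Rightarrow> ('a \<Rightarrow> 'b::real_normed_vector) \<Rightarrow> bool" where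
  "smooth_on S f \<longleftrightarrow> (\<forall>n. differentiable_times n S f)"

type_synonym ('m, 'n) chart_map = "'m \<Rightarrow> real^'n"
type_synonym ('m, 'n) atlas = "('m set \<times> ('m, 'n) chart_map) set"

text \<open>
  A smooth atlas (not necessarily maximal) on the whole type \<open>'m\<close>, whose topology is Hausdorff and
  second countable by its type class.
\<close>

definition smooth_manifold ::
  "('m::{t2_space,second_countable_topology}, 'n::finite) atlas \<Rightarrow> bool" where
  "smooth_manifold M \<longleftrightarrow>
     (\<Union>(U, \<phi>)\<in>M. U) = UNIV \<and>
     (\<forall>(U, \<phi>)\<in>M. open U \<and> open (\<phi> ` U) \<and> homeomorphism U (\<phi> ` U) \<phi> (inv_into U \<phi>)) \<and>
     (\<forall>(U, \<phi>)\<in>M. \<forall>(V, \<psi>)\<in>M. smooth_on (\<phi> ` (U \<inter> V)) (\<psi> \<circ> inv_into U \<phi>))"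

definition smooth_fun ::
  "('m::topological_space, 'n::finite) atlas \<Rightarrow> 'm set \<Rightarrow> ('m \<Rightarrow> real) \<Rightarrow> bool" where
  "smooth_fun M W f \<longleftrightarrow>
     open W \<and> (\<forall>(U, \<phi>)\<in>M. smooth_on (\<phi> ` (U \<inter> W)) (f \<circ> inv_into U \<phi>))"

definition smooth_near ::
  "('m::topological_space, 'n::finite) atlas \<Rightarrow> 'm \<Rightarrow> ('m \<Rightarrow> real) \<Rightarrow> bool" where
  "smooth_near M p f \<longleftrightarrow> (\<exists>W. p \<in> W \<and> smooth_fun M W f)"

text \<open>
  A tangent vector at \<open>p\<close> is the pair of \<open>p\<close> and a derivation of the germs at \<open>p\<close> of smooth
  functions. The derivation is given on representatives; it is set to \<open>0\<close> on functions which are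
  not smooth near \<open>p\<close>, so that equality of tangent vectors is equality in the type.
\<close>

type_synonym 'm tvec = "'m \<times> (('m \<Rightarrow> real) \<Rightarrow> real)"

definition derivation_at ::
  "('m::topological_space, 'n::finite) atlas \<Rightarrow> 'm \<Rightarrow> (('m \<Rightarrow> real) \<Rightarrow> real) \<Rightarrow> bool" where
  "derivation_at M p v \<longleftrightarrow>
     (\<forall>f. \<not> smooth_near M p f \<longrightarrow> v f = 0) \<and>
     (\<forall>f g W. open W \<and> p \<in> W \<and> (\<forall>q\<in>W. f q = g q) \<longrightarrow> v f = v g) \<and>
     (\<forall>f g. smooth_near M p f \<and> smooth_near M p g \<longrightarrow>
        v (\<lambda>q. f q + g q) = v f + v g \<and>
        v (\<lambda>q. f q * g q) = v f * g p + f p * v g) \<and>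
     (\<forall>f r. smooth_near M p f \<longrightarrow> v (\<lambda>q. r * f q) = r * v f)"

text \<open>The components \<open>dx i (v)\<close> of a tangent vector in the chart \<open>\<phi>\<close>.\<close>

definition components :: "('m \<Rightarrow> real^'n) \<Rightarrow> 'm tvec \<Rightarrow> real^'n" where
  "components \<phi> v = (\<chi> i. snd v (\<lambda>q. \<phi> q $ i))"

definition coord_field ::
  "('m::topological_space, 'n::finite) atlas \<Rightarrow> 'm set \<Rightarrow> ('m \<Rightarrow> real^'n) \<Rightarrow> 'n \<Rightarrow> 'm \<Rightarrow> 'm tvec" where
  "coord_field M U \<phi> j p = (p, \<lambda>f. if smooth_near M p f
     then frechet_derivative (f \<circ> inv_into U \<phi>) (at (\<phi> p)) (axis j 1) else 0)"

definition lie_bracket ::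
  "('m::topological_space, 'n::finite) atlas \<Rightarrow> ('m \<Rightarrow> 'm tvec) \<Rightarrow> ('m \<Rightarrow> 'm tvec) \<Rightarrow> 'm \<Rightarrow> 'm tvec" where
  "lie_bracket M X Y p = (p, \<lambda>f. if smooth_near M p f
     then snd (X p) (\<lambda>q. snd (Y q) f) - snd (Y p) (\<lambda>q. snd (X q) f) else 0)"


section \<open>Vector bundles and connections\<close>

text \<open>
  A local trivialization is an open set \<open>U\<close> with a map \<open>\<psi>\<close> which is a linear isomorphism from the
  fibre over each point of \<open>U\<close> to \<open>real^'r\<close>. The smooth structure of the total space is the one
  determined by the trivializations.
\<close>

record ('m, 'e, 'r) vbundle =
  total :: "'e set"
  proj :: "'e \<Rightarrow> 'm"
  fib_add :: "'e \<Rightarrow> 'e \<Rightarrow> 'e"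
  fib_scale :: "real \<Rightarrow> 'e \<Rightarrow> 'e"
  trivs :: "('m set \<times> ('e \<Rightarrow> (real, 'r) vec)) set"

definition fibre :: "('m, 'e, 'r::finite) vbundle \<Rightarrow> 'm \<Rightarrow> 'e set" where
  "fibre E p = {e \<in> total E. proj E e = p}"

definition vector_bundle ::
  "('m::topological_space, 'n::finite) atlas \<Rightarrow> ('m, 'e, 'r::finite) vbundle \<Rightarrow> bool" where
  "vector_bundle M E \<longleftrightarrow>
     (\<Union>(U, \<psi>)\<in>trivs E. U) = UNIV \<and>
     (\<forall>(U, \<psi>)\<in>trivs E. open U \<and>
        (\<forall>p\<in>U. bij_betw \<psi> (fibre E p) UNIV \<and>
           (\<forall>e\<in>fibre E p. \<forall>e'\<in>fibre E p.
              fib_add E e e' \<in> fibre E p \<and> \<psi> (fib_add E e e') = \<psi> e + \<psi> e') \<and>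
           (\<forall>e\<in>fibre E p. \<forall>r.
              fib_scale E r e \<in> fibre E p \<and> \<psi> (fib_scale E r e) = r *\<^sub>R \<psi> e))) \<and>
     (\<forall>(U, \<psi>)\<in>trivs E. \<forall>(V, \<theta>)\<in>trivs E. \<exists>g :: 'm \<Rightarrow> real^'r^'r.
        (\<forall>i j. smooth_fun M (U \<inter> V) (\<lambda>p. g p $ i $ j)) \<and>
        (\<forall>p\<in>U \<inter> V. \<forall>e\<in>fibre E p. \<theta> e = g p *v \<psi> e))"

definition tangent_bundle ::
  "('m::topological_space, 'n::finite) atlas \<Rightarrow> ('m, 'm tvec, 'n) vbundle" where
  "tangent_bundle M =
     \<lparr>total = {(p, v). derivation_at M p v},
      proj = fst,
      fib_add = (\<lambda>v w. (fst v, \<lambda>f. snd v f + snd w f)),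
      fib_scale = (\<lambda>r v. (fst v, \<lambda>f. r * snd v f)),
      trivs = {(U, components \<phi>) | U \<phi>. (U, \<phi>) \<in> M}\<rparr>"

definition smooth_section ::
  "('m::topological_space, 'n::finite) atlas \<Rightarrow> ('m, 'e, 'r::finite) vbundle \<Rightarrow> 'm set \<Rightarrow>
   ('m \<Rightarrow> 'e) \<Rightarrow> bool" where
  "smooth_section M E W s \<longleftrightarrow>
     open W \<and> (\<forall>p\<in>W. s p \<in> fibre E p) \<and>
     (\<forall>(U, \<psi>)\<in>trivs E. \<forall>i. smooth_fun M (U \<inter> W) (\<lambda>p. \<psi> (s p) $ i))"

text \<open>
  A connection is a covariant derivative \<open>D s v\<close> of sections \<open>s\<close> in the direction of tangent
  vectors \<open>v\<close>. It acts on local sections (those smooth on an open neighbourhood \<open>W\<close> of the base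
  point of \<open>v\<close>) and depends on their germs only, so that it can be applied to local frames; by
  means of cut-off functions these operators correspond bijectively to those on global sections.
\<close>

type_synonym ('m, 'e) conn = "('m \<Rightarrow> 'e) \<Rightarrow> 'm tvec \<Rightarrow> 'e"

definition connection ::
  "('m::topological_space, 'n::finite) atlas \<Rightarrow> ('m, 'e, 'r::finite) vbundle \<Rightarrow> ('m, 'e) conn \<Rightarrow> bool"
where
  "connection M E D \<longleftrightarrow>
     (\<forall>W s. smooth_section M E W s \<longrightarrow>
        (\<forall>p\<in>W. \<forall>v\<in>fibre (tangent_bundle M) p.
           D s v \<in> fibre E p \<and>
           (\<forall>w\<in>fibre (tangent_bundle M) p.
              D s (fib_add (tangent_bundle M) v w) = fib_add E (D s v) (D s w)) \<and>
           (\<forall>r. D s (fib_scale (tangent_bundle M) r v) = fib_scale E r (D s v)) \<and>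
           (\<forall>s'. (\<forall>q\<in>W. s' q = s q) \<longrightarrow> D s' v = D s v) \<and>
           (\<forall>s'. smooth_section M E W s' \<longrightarrow>
              D (\<lambda>q. fib_add E (s q) (s' q)) v = fib_add E (D s v) (D s' v)) \<and>
           (\<forall>f. smooth_fun M W f \<longrightarrow>
              D (\<lambda>q. fib_scale E (f q) (s q)) v =
                fib_add E (fib_scale E (snd v f) (s p)) (fib_scale E (f p) (D s v)))) \<and>
        (\<forall>X. smooth_section M (tangent_bundle M) W X \<longrightarrow>
           smooth_section M E W (\<lambda>q. D s (X q))))"

definition fib_sub :: "('m, 'e, 'r::finite) vbundle \<Rightarrow> 'e \<Rightarrow> 'e \<Rightarrow> 'e" where
  "fib_sub E e e' = fib_add E e (fib_scale E (- 1) e')"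

definition conn_difference ::
  "('m, 'e, 'r::finite) vbundle \<Rightarrow> ('m, 'e) conn \<Rightarrow> ('m, 'e) conn \<Rightarrow> ('m, 'e) conn" where
  "conn_difference E D1 D0 = (\<lambda>s v. fib_sub E (D1 s v) (D0 s v))"

definition conn_path ::
  "('m, 'e, 'r::finite) vbundle \<Rightarrow> ('m, 'e) conn \<Rightarrow> ('m, 'e) conn \<Rightarrow> real \<Rightarrow> ('m, 'e) conn" where
  "conn_path E D0 D1 t = (\<lambda>s v. fib_add E (fib_scale E (1 - t) (D0 s v)) (fib_scale E t (D1 s v)))"

definition curvature ::
  "('m::topological_space, 'n::finite) atlas \<Rightarrow> ('m, 'e, 'r::finite) vbundle \<Rightarrow> ('m, 'e) conn \<Rightarrow>
   ('m \<Rightarrow> 'm tvec) \<Rightarrow> ('m \<Rightarrow> 'm tvec) \<Rightarrow> ('m \<Rightarrow> 'e) \<Rightarrow> 'm \<Rightarrow> 'e" where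
  "curvature M E D X Y s p =
     fib_sub E (fib_sub E (D (\<lambda>q. D s (Y q)) (X p)) (D (\<lambda>q. D s (X q)) (Y p)))
       (D s (lie_bracket M X Y p))"

definition bundle_metric ::
  "('m::topological_space, 'n::finite) atlas \<Rightarrow> ('m, 'e, 'r::finite) vbundle \<Rightarrow>
   ('e \<Rightarrow> 'e \<Rightarrow> real) \<Rightarrow> bool" where
  "bundle_metric M E h \<longleftrightarrow>
     (\<forall>p. \<forall>e\<in>fibre E p.
        (\<forall>e'\<in>fibre E p. h e e' = h e' e \<and>
           (\<forall>e''\<in>fibre E p. h (fib_add E e e') e'' = h e e'' + h e' e'') \<and>
           (\<forall>r. h (fib_scale E r e) e' = r * h e e')) \<and>
        (e \<noteq> fib_scale E 0 e \<longrightarrow> h e e > 0)) \<and>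
     (\<forall>W s s'. smooth_section M E W s \<and> smooth_section M E W s' \<longrightarrow>
        smooth_fun M W (\<lambda>p. h (s p) (s' p)))"

definition euclidean_connection ::
  "('m::topological_space, 'n::finite) atlas \<Rightarrow> ('m, 'e, 'r::finite) vbundle \<Rightarrow>
   ('e \<Rightarrow> 'e \<Rightarrow> real) \<Rightarrow> ('m, 'e) conn \<Rightarrow> bool" where
  "euclidean_connection M E h D \<longleftrightarrow>
     connection M E D \<and>
     (\<forall>W s s'. smooth_section M E W s \<and> smooth_section M E W s' \<longrightarrow>
        (\<forall>p\<in>W. \<forall>v\<in>fibre (tangent_bundle M) p.
           snd v (\<lambda>q. h (s q) (s' q)) = h (D s v) (s' p) + h (s p) (D s' v)))"

text \<open>
  An orientation of a bundle of rank 2: \<open>ori e e'\<close> says that \<open>(e, e')\<close> is a positively oriented basis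
  of its fibre. It is locally constant, i.e. given near each point by the sign of the determinant
  in some trivialization, up to a fixed sign \<open>\<epsilon>\<close>.
\<close>

definition orientation ::
  "('m::topological_space, 'e, 2) vbundle \<Rightarrow> ('e \<Rightarrow> 'e \<Rightarrow> bool) \<Rightarrow> bool" where
  "orientation E ori \<longleftrightarrow>
     (\<forall>p. \<exists>(U, \<psi>)\<in>trivs E. \<exists>V \<epsilon>. open V \<and> p \<in> V \<and> V \<subseteq> U \<and> \<epsilon> \<in> {1, - 1} \<and>
        (\<forall>q\<in>V. \<forall>e\<in>fibre E q. \<forall>e'\<in>fibre E q.
           ori e e' \<longleftrightarrow> \<epsilon> * det (vector [\<psi> e, \<psi> e'] :: real^2^2) > 0))"

definition oriented_orthonormal_frame ::
  "('m::topological_space, 'n::finite) atlas \<Rightarrow> ('m, 'e, 2) vbundle \<Rightarrow> ('e \<Rightarrow> 'e \<Rightarrow> real) \<Rightarrow>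
   ('e \<Rightarrow> 'e \<Rightarrow> bool) \<Rightarrow> 'm set \<Rightarrow> ('m \<Rightarrow> 'e) \<times> ('m \<Rightarrow> 'e) \<Rightarrow> bool" where
  "oriented_orthonormal_frame M E h ori W = (\<lambda>(e1, e2).
     smooth_section M E W e1 \<and> smooth_section M E W e2 \<and>
     (\<forall>q\<in>W. h (e1 q) (e1 q) = 1 \<and> h (e2 q) (e2 q) = 1 \<and> h (e1 q) (e2 q) = 0 \<and>
        ori (e1 q) (e2 q)))"

text \<open>
  The Euler form \<open>h (R e2) e1 / (2 pi)\<close>, the Pfaffian of \<open>R / (2 pi)\<close> in an oriented orthonormal
  frame \<open>(e1, e2)\<close> near \<open>p\<close>. It does not depend on the frame, as \<open>R\<close> is tensorial and skew. Since
  \<open>R e2 = 2 pi c e1\<close> and \<open>R e1 = - 2 pi c e2\<close>, the eigenvalues of \<open>(i / 2 pi) R\<close> are \<open>c\<close> and \<open>- c\<close>.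
\<close>

definition euler_form ::
  "('m::topological_space, 'n::finite) atlas \<Rightarrow> ('m, 'e, 2) vbundle \<Rightarrow> ('e \<Rightarrow> 'e \<Rightarrow> real) \<Rightarrow>
   ('e \<Rightarrow> 'e \<Rightarrow> bool) \<Rightarrow> ('m, 'e) conn \<Rightarrow> ('m \<Rightarrow> 'm tvec) \<Rightarrow> ('m \<Rightarrow> 'm tvec) \<Rightarrow> 'm \<Rightarrow> real" where
  "euler_form M E h ori D X Y p =
     (let (e1, e2) = (SOME e. \<exists>W. p \<in> W \<and> oriented_orthonormal_frame M E h ori W e)
      in h (curvature M E D X Y e2 p) (e1 p) / (2 * pi))"


section \<open>Differential forms in a chart\<close>

text \<open>
  The values at \<open>p\<close>, in the chart \<open>(U, \<phi>)\<close>, of the \<open>End TM\<close>-valued 1-form \<open>D1 - D0\<close>, of the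
  \<open>End TM\<close>-valued curvature 2-form, and of the Euler form. Endomorphisms are written as matrices
  with respect to the coordinate frame: \<open>B (coord_field j) = (\<Sum>i. B $ i $ j coord_field i)\<close>.
\<close>

type_synonym 'n form_matrix = "'n exterior^'n^'n"

definition difference_matrix ::
  "('m::topological_space, 'n::{finite,linorder}) atlas \<Rightarrow> 'm set \<Rightarrow> ('m, 'n) chart_map \<Rightarrow> 'm \<Rightarrow>
   ('m, 'm tvec) conn \<Rightarrow> ('m, 'm tvec) conn \<Rightarrow> 'n form_matrix" where
  "difference_matrix M U \<phi> p D1 D0 = (\<chi> i j. form1 (\<lambda>a.
     components \<phi> (conn_difference (tangent_bundle M) D1 D0
       (coord_field M U \<phi> j) (coord_field M U \<phi> a p)) $ i))"

definition curvature_matrix ::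
  "('m::topological_space, 'n::{finite,linorder}) atlas \<Rightarrow> 'm set \<Rightarrow> ('m, 'n) chart_map \<Rightarrow> 'm \<Rightarrow>
   ('m, 'm tvec) conn \<Rightarrow> 'n form_matrix" where
  "curvature_matrix M U \<phi> p D = (\<chi> i j. form2 (\<lambda>a b.
     components \<phi> (curvature M (tangent_bundle M) D
       (coord_field M U \<phi> a) (coord_field M U \<phi> b) (coord_field M U \<phi> j) p) $ i))"

definition euler_form_in_chart ::
  "('m::topological_space, 'n::{finite,linorder}) atlas \<Rightarrow> 'm set \<Rightarrow> ('m, 'n) chart_map \<Rightarrow> 'm \<Rightarrow>
   ('m, 'e, 2) vbundle \<Rightarrow> ('e \<Rightarrow> 'e \<Rightarrow> real) \<Rightarrow> ('e \<Rightarrow> 'e \<Rightarrow> bool) \<Rightarrow> ('m, 'e) conn \<Rightarrow> 'n exterior" where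
  "euler_form_in_chart M U \<phi> p E h ori D = form2 (\<lambda>a b.
     euler_form M E h ori D (coord_field M U \<phi> a) (coord_field M U \<phi> b) p)"

end

theory Submission
  imports Defs
begin

text \<open>
  The identity already holds for the integrands, at every \<open>t\<close>. In degree 11 the forms on both sides
  are combinations of \<open>tr (A R)\<close>, \<open>tr (A R^3)\<close>, \<open>tr (A R^5)\<close> with coefficients in the commuting even
  forms \<open>tr (R^2)\<close>, \<open>tr (R^4)\<close> and \<open>c\<close>, so the claim reduces to seven numerical identities between
  Taylor coefficients. As the connections need not be metric, \<open>tr R\<close>, \<open>tr (R^3)\<close>, \<open>tr (R^5)\<close> do
  occur in the Chern character, but their contributions have degree 1 modulo 4.

  Integrating the identity requires the integrands to be integrable. They are continuous in \<open>t\<close>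
  since the curvature of \<open>(1 - t) D0 + t D1\<close> is a quadratic polynomial in \<open>t\<close>; this uses the
  linearity of \<open>D0\<close> and \<open>D1\<close> on sections, hence the smoothness of the coordinate vector fields.
\<close>

text \<open>The series inside the traces are logarithmic derivatives. As sinh(ix) = i sin x, the
  series behind \<open>A_hat\<close> is (z/4pi)/sin(z/4pi), and half its logarithm has derivative
  \<open>tan_series\<close>. Half the logarithm of (z/2pi)/tan(z/4pi), the series behind
  \<open>L_hat\<close>, has derivative \<open>sin_series\<close>, and -(1/2pi) sin(z/2pi) is the
  derivative of cos(z/2pi), the even part of the Chern character series. So the two sides are, in
  degree 11, the transgressions of sqrt 2 L/cosh^2(c/2) and of 8 A cosh(c/2) (ch - 3(e^c + e^-c - 2)
  - 3); the last -3 is the source of the separate multiple of \<open>tan_series\<close>. The factor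
  sqrt 2 makes up for the odd rank: \<open>L_hat\<close> has constant term 2^(11/2), and sqrt 2
  times that is 64.

  The forms do not commute in general, so commutative ring normalization cannot be applied to the
  products. Instead each factor is split into its homogeneous components, the order of factors is
  kept with the odd trace on the right, and commutativity is invoked only for the even forms that
  have to change places.\<close>

unbundle no fps_syntax

section \<open>The grading of the exterior algebra\<close>

text \<open>The type class structure of \<open>exterior\<close> is real, while the power series have
  complex coefficients. All scalars, including real ones, numerals and \<open>ext_const\<close>, are
  brought into this one form.\<close>

definition cscale :: "complex \<Rightarrow> 'n exterior \<Rightarrow> 'n exterior" where
  "cscale z a = Ext (\<lambda>S. z * coeff_at a S)"

lemma coeff_at_cscale [simp]: "coeff_at (cscale z a) S = z * coeff_at a S"
  by (simp add: cscale_def)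

lemma cscale_mult:
  fixes a b :: "'n::{finite,linorder} exterior"
  shows "cscale z a * b = cscale z (a * b)" "a * cscale z b = cscale z (a * b)"
  by (simp_all add: exterior_eq_iff times_exterior_def sum_distrib_left mult_ac)

lemma cscale_cscale: "cscale z (cscale w a) = cscale (z * w) a"
  by (simp add: exterior_eq_iff mult_ac)

lemma cscale_add: "cscale z (a + b) = cscale z a + cscale z b"
  by (simp add: exterior_eq_iff algebra_simps)

lemma cscale_sum: "cscale z (\<Sum>i\<in>I. f i) = (\<Sum>i\<in>I. cscale z (f i))"
proof (induction I rule: infinite_finite_induct)
  case (insert i I)
  then show ?case by (simp add: cscale_add)
qed (simp_all add: exterior_eq_iff)

lemma scaleR_eq_cscale: "r *\<^sub>R a = cscale (of_real r) a"
  by (simp add: exterior_eq_iff scaleR_conv_of_real)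

lemma cscale_one [simp]: "cscale 1 a = a" and cscale_zero [simp]: "cscale 0 a = 0" "cscale z 0 = 0"
  by (simp_all add: exterior_eq_iff)

lemma ext_const_eq: "ext_const z = cscale z (1 :: 'n::{finite,linorder} exterior)"
  by (simp add: exterior_eq_iff ext_const_def one_exterior_def)

lemma ext_const_mult:
  fixes a :: "'n::{finite,linorder} exterior"
  shows "ext_const z * a = cscale z a"
  by (simp add: ext_const_eq cscale_mult)

lemma numeral_mult_eq_cscale:
  fixes a :: "'n::{finite,linorder} exterior"
  shows "numeral k * a = cscale (numeral k) a"
proof -
  have "numeral k * a = of_real (numeral k) * a" by simp
  also have "\<dots> = cscale (numeral k) a"
    unfolding of_real_def by (simp add: scaleR_eq_cscale cscale_mult)
  finally show ?thesis .
qed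

lemma bounded_linear_cscale:
  "bounded_linear (cscale z :: 'n::{finite,linorder} exterior \<Rightarrow> _)"
proof (rule bounded_linear_intro[where K = "norm z"])
  show "norm (cscale z a) \<le> norm a * norm z" for a :: "'n exterior"
    by (simp add: norm_exterior_def norm_mult sum_distrib_left mult.commute)
qed (simp_all add: exterior_eq_iff algebra_simps)

lemma bounded_linear_cscale_right:
  "bounded_linear (\<lambda>z. cscale z (a :: 'n::{finite,linorder} exterior))"
proof (rule bounded_linear_intro[where K = "norm a"])
  show "norm (cscale z a) \<le> norm z * norm a" for z
    by (simp add: norm_exterior_def norm_mult sum_distrib_left)
qed (simp_all add: exterior_eq_iff algebra_simps)

lemma continuous_on_cscale [continuous_intros]:
  fixes f :: "'b::topological_space \<Rightarrow> 'n::{finite,linorder} exterior"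
  shows "continuous_on S f \<Longrightarrow> continuous_on S (\<lambda>x. cscale z (f x))"
  by (rule bounded_linear.continuous_on[OF bounded_linear_cscale])

definition homogeneous :: "nat \<Rightarrow> 'n exterior \<Rightarrow> bool" where
  "homogeneous k a \<longleftrightarrow> (\<forall>S. card S \<noteq> k \<longrightarrow> coeff_at a S = 0)"

lemma homogeneous_intros [intro]:
  "homogeneous k 0"
  "homogeneous k a \<Longrightarrow> homogeneous k b \<Longrightarrow> homogeneous k (a + b)"
  "homogeneous k a \<Longrightarrow> homogeneous k (cscale z a)"
  "homogeneous k a \<Longrightarrow> homogeneous k (r *\<^sub>R a)"
  by (simp_all add: homogeneous_def)

lemma homogeneous_sum: "(\<And>i. i \<in> I \<Longrightarrow> homogeneous k (f i)) \<Longrightarrow> homogeneous k (\<Sum>i\<in>I. f i)"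
  by (induction I rule: infinite_finite_induct) auto

lemma homogeneous_one: "homogeneous 0 (1 :: 'n::{finite,linorder} exterior)"
  by (simp add: homogeneous_def one_exterior_def)

lemma homogeneous_dx: "homogeneous 1 (dx i)"
  by (auto simp: homogeneous_def dx_def)

lemma homogeneous_mult:
  fixes a b :: "'n::{finite,linorder} exterior"
  assumes "homogeneous k a" "homogeneous l b"
  shows "homogeneous (k + l) (a * b)"
  unfolding homogeneous_def times_exterior_def coeff_at_Ext
proof (intro allI impI sum.neutral ballI)
  fix S T :: "'n set"
  assume S: "card S \<noteq> k + l" and T: "T \<in> Pow S"
  then have "card S = card T + card (S - T)"
    by (metis PowD card_Diff_subset card_mono finite le_add_diff_inverse)
  then have "card T \<noteq> k \<or> card (S - T) \<noteq> l" using S by auto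
  then show "shuffle_sign T (S - T) * coeff_at a T * coeff_at b (S - T) = 0"
    using assms by (auto simp: homogeneous_def)
qed

lemma homogeneous_power:
  "homogeneous k (a :: 'n::{finite,linorder} exterior) \<Longrightarrow> homogeneous (k * m) (a ^ m)"
  by (induction m) (auto intro: homogeneous_one homogeneous_mult)

text \<open>A set of generators has at most \<open>CARD('n)\<close> elements. This is what truncates
  every power series below.\<close>

lemma homogeneous_above_top:
  fixes a :: "'n::{finite,linorder} exterior"
  assumes "homogeneous k a" "CARD('n) < k"
  shows "a = 0"
proof -
  have "card S \<noteq> k" for S :: "'n set"
    using assms(2) card_mono[of UNIV S] by auto
  then show ?thesis using assms(1) by (simp add: exterior_eq_iff homogeneous_def)
qed

lemma degree_part_homogeneous: "homogeneous k a \<Longrightarrow> degree_part l a = (if l = k then a else 0)"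
  by (auto simp: exterior_eq_iff homogeneous_def degree_part_def)

lemma degree_part_add: "degree_part k (a + b) = degree_part k a + degree_part k b"
  by (simp add: exterior_eq_iff degree_part_def)

lemma bounded_linear_degree_part:
  "bounded_linear (degree_part k :: 'n::{finite,linorder} exterior \<Rightarrow> _)"
proof (rule bounded_linear_intro[where K = 1])
  show "norm (degree_part k a) \<le> norm a * 1" for a :: "'n exterior"
    unfolding norm_exterior_def by (simp add: degree_part_def sum_mono)
qed (simp_all add: exterior_eq_iff degree_part_def)

text \<open>After exchanging coordinates, the inversions of \<open>(U, T)\<close> are the complement
  in \<open>T \<times> U\<close> of those of \<open>(T, U)\<close>. The product has even
  cardinality, so both counts have the same parity.\<close>

lemma shuffle_sign_commute:
  fixes T U :: "'n::{finite,linorder} set"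
  assumes "T \<inter> U = {}" "even (card T)"
  shows "shuffle_sign U T = shuffle_sign T U"
proof -
  have fin: "finite (inversions T U)" "finite (inversions U T)" by simp_all
  have swap: "card (inversions U T) = card {(i, j). i \<in> T \<and> j \<in> U \<and> i < j}"
    by (rule bij_betw_same_card[where f = prod.swap])
      (force simp: bij_betw_def inj_on_def inversions_def image_iff)
  have un: "inversions T U \<union> {(i, j). i \<in> T \<and> j \<in> U \<and> i < j} = T \<times> U"
    using assms(1) by (force simp: inversions_def)
  have "card (inversions T U) + card {(i, j). i \<in> T \<and> j \<in> U \<and> i < j} = card (T \<times> U)"
    by (subst card_Un_disjoint[symmetric]) (simp_all only: un finite, auto simp: inversions_def)
  then have "even (card (inversions T U) + card (inversions U T))"
    using assms(2) by (simp add: swap card_cartesian_product)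
  then show ?thesis
    by (simp add: shuffle_sign_def uminus_power_if)
qed

text \<open>Only sets \<open>T\<close> of even size \<open>k\<close> carry a coefficient of
  \<open>a\<close>, and for these the sign is symmetric; taking complements in \<open>S\<close> then
  exchanges the two factors. No homogeneity of \<open>b\<close> enters, so this also covers mixed
  degrees.\<close>

lemma even_homogeneous_commute:
  fixes a b :: "'n::{finite,linorder} exterior"
  assumes "homogeneous k a" "even k"
  shows "a * b = b * a"
  unfolding exterior_eq_iff
proof
  fix S :: "'n set"
  have "coeff_at (a * b) S = (\<Sum>T\<in>Pow S. shuffle_sign (S - T) T * coeff_at a T * coeff_at b (S - T))"
    unfolding times_exterior_def coeff_at_Ext
  proof (rule sum.cong)
    fix T assume "T \<in> Pow S"
    show "shuffle_sign T (S - T) * coeff_at a T * coeff_at b (S - T) =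
          shuffle_sign (S - T) T * coeff_at a T * coeff_at b (S - T)"
    proof (cases "card T = k")
      case True
      then have "shuffle_sign (S - T) T = shuffle_sign T (S - T)"
        using assms(2) by (intro shuffle_sign_commute) auto
      then show ?thesis by simp
    qed (use assms(1) in \<open>simp add: homogeneous_def\<close>)
  qed simp
  also have "\<dots> = (\<Sum>T\<in>Pow S. shuffle_sign T (S - T) * coeff_at b T * coeff_at a (S - T))"
    by (rule sum.reindex_bij_witness[where i = "\<lambda>T. S - T" and j = "\<lambda>T. S - T"])
      (auto simp: double_diff)
  finally show "coeff_at (a * b) S = coeff_at (b * a) S"
    by (simp add: times_exterior_def)
qed

text \<open>
  In dimension 11 every factor in the identity, except for the Chern character, which is a sum of two
  such forms, has at most three homogeneous components, in degrees congruent modulo 4. For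
  \<open>r = 3\<close> the last one is the component of degree 11.
\<close>

definition components4 ::
  "nat \<Rightarrow> 'n exterior \<Rightarrow> 'n exterior \<Rightarrow> 'n exterior \<Rightarrow> 'n exterior \<Rightarrow> bool" where
  "components4 r x x0 x1 x2 \<longleftrightarrow> x = x0 + x1 + x2 \<and>
     homogeneous r x0 \<and> homogeneous (r + 4) x1 \<and> homogeneous (r + 8) x2"

text \<open>The discarded products have degree at least 12 and vanish. In each product the factor
  from \<open>x\<close> stays on the left, so no commutativity is used.\<close>

lemma components4_mult:
  fixes x y :: "'n::{finite,linorder} exterior"
  assumes "components4 r x x0 x1 x2" "components4 s y y0 y1 y2" "CARD('n) < 12"
  shows "components4 (r + s) (x * y) (x0 * y0) (x0 * y1 + x1 * y0) (x0 * y2 + x1 * y1 + x2 * y0)"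
proof -
  have h: "homogeneous r x0" "homogeneous (r + 4) x1" "homogeneous (r + 8) x2"
    "homogeneous s y0" "homogeneous (s + 4) y1" "homogeneous (s + 8) y2"
    using assms by (auto simp: components4_def)
  have z: "x1 * y2 = 0" "x2 * y1 = 0" "x2 * y2 = 0"
    using homogeneous_mult[OF h(2,6)] homogeneous_mult[OF h(3,5)] homogeneous_mult[OF h(3,6)]
    by (auto elim: homogeneous_above_top simp: assms(3) less_le_trans[OF assms(3)])
  have g: "homogeneous (r + s) (x0 * y0)"
    "homogeneous (r + s + 4) (x0 * y1)" "homogeneous (r + s + 4) (x1 * y0)"
    "homogeneous (r + s + 8) (x0 * y2)" "homogeneous (r + s + 8) (x1 * y1)"
    "homogeneous (r + s + 8) (x2 * y0)"
    using homogeneous_mult[OF h(1,4)] homogeneous_mult[OF h(1,5)] homogeneous_mult[OF h(2,4)]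
      homogeneous_mult[OF h(1,6)] homogeneous_mult[OF h(2,5)] homogeneous_mult[OF h(3,4)]
    by (simp_all add: add_ac)
  have "x * y = x0 * y0 + (x0 * y1 + x1 * y0) + (x0 * y2 + x1 * y1 + x2 * y0)"
    using assms(1,2) z unfolding components4_def by (simp add: algebra_simps)
  then show ?thesis
    unfolding components4_def using g by auto
qed

lemma components4_add:
  assumes "components4 r x x0 x1 x2" "components4 r y y0 y1 y2"
  shows "components4 r (x + y) (x0 + y0) (x1 + y1) (x2 + y2)"
  using assms unfolding components4_def by (auto simp: algebra_simps)

lemma components4_cscale:
  assumes "components4 r x x0 x1 x2"
  shows "components4 r (cscale z x) (cscale z x0) (cscale z x1) (cscale z x2)"
  using assms unfolding components4_def by (auto simp: cscale_add)

lemma degree_part_components4: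
  assumes "components4 r x x0 x1 x2"
  shows "degree_part (r + 8) x = x2" and "k mod 4 \<noteq> r mod 4 \<Longrightarrow> degree_part k x = 0"
proof -
  have "(r + 4) mod 4 = r mod 4" "(r + 8) mod 4 = r mod 4" by presburger+
  then show "degree_part (r + 8) x = x2" "k mod 4 \<noteq> r mod 4 \<Longrightarrow> degree_part k x = 0"
    using assms unfolding components4_def by (auto simp: degree_part_add degree_part_homogeneous)
qed

section \<open>Taylor coefficients\<close>

text \<open>Writing f = c(1 + u), the chain rule gives (log f)' = u'/(1 + u). In the multiplied form
  the equation determines the coefficients of the logarithm recursively, with no need to expand the
  composition in \<open>fps_log\<close>.\<close>

lemma fps_log_deriv:
  fixes f :: "complex fps"
  assumes "fps_nth f 0 \<noteq> 0"
  shows "f * fps_deriv (fps_log f) = fps_deriv f"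
proof -
  define c where "c = fps_nth f 0"
  define u where "u = f / fps_const c - 1"
  have c: "c \<noteq> 0" using assms by (simp add: c_def)
  have f: "f = fps_const c * (1 + u)"
    unfolding u_def using c by (simp add: fps_divide_unit fps_const_inverse field_simps)
  have u0: "fps_nth u 0 = 0"
    using f c c_def
    by (metis add_cancel_left_right fps_add_nth fps_mult_nth_0 fps_nth_fps_const fps_one_nth
        mult_cancel_left2)
  have "fps_deriv (fps_log f) = (inverse (1 + fps_X) oo u) * fps_deriv u"
    unfolding fps_log_def c_def[symmetric] u_def[symmetric]
    by (simp add: fps_compose_deriv[OF u0] fps_ln_deriv)
  also have "inverse (1 + fps_X) oo u = inverse (1 + u)"
    using u0 by (simp add: fps_inverse_compose fps_compose_add_distrib)
  finally have "f * fps_deriv (fps_log f) = fps_const c * ((1 + u) * inverse (1 + u)) * fps_deriv u"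
    by (simp add: f mult_ac)
  also have "(1 + u) * inverse (1 + u) = 1"
    using u0 by (simp add: inverse_mult_eq_1')
  finally show ?thesis by (simp add: f)
qed

lemma fps_log_nth_0: "fps_nth (fps_log f) 0 = ln (fps_nth f 0)"
  by (simp add: fps_log_def)

lemma fps_nth_product_low:
  fixes f g :: "complex fps"
  shows "fps_nth (f * g) 1 = fps_nth f 0 * fps_nth g 1 + fps_nth f 1 * fps_nth g 0"
    and "fps_nth (f * g) 2 = fps_nth f 0 * fps_nth g 2 + fps_nth f 1 * fps_nth g 1 + fps_nth f 2 * fps_nth g 0"
    and "fps_nth (f * g) 3 = fps_nth f 0 * fps_nth g 3 + fps_nth f 1 * fps_nth g 2 + fps_nth f 2 * fps_nth g 1
      + fps_nth f 3 * fps_nth g 0"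
    and "fps_nth (f * g) 4 = fps_nth f 0 * fps_nth g 4 + fps_nth f 1 * fps_nth g 3 + fps_nth f 2 * fps_nth g 2
      + fps_nth f 3 * fps_nth g 1 + fps_nth f 4 * fps_nth g 0"
    and "fps_nth (f * g) 5 = fps_nth f 0 * fps_nth g 5 + fps_nth f 1 * fps_nth g 4 + fps_nth f 2 * fps_nth g 3
      + fps_nth f 3 * fps_nth g 2 + fps_nth f 4 * fps_nth g 1 + fps_nth f 5 * fps_nth g 0"
    and "fps_nth (f * g) 6 = fps_nth f 0 * fps_nth g 6 + fps_nth f 1 * fps_nth g 5 + fps_nth f 2 * fps_nth g 4
      + fps_nth f 3 * fps_nth g 3 + fps_nth f 4 * fps_nth g 2 + fps_nth f 5 * fps_nth g 1 + fps_nth f 6 * fps_nth g 0"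
  by (simp_all add: fps_mult_nth atLeast0AtMost eval_nat_numeral atMost_Suc)

lemmas fps_nth_mult_expand = fps_mult_nth_0 fps_nth_product_low fps_nth_product_low(1)[folded One_nat_def]

text \<open>Coefficients 0 to 4 of f l' = f' are solved successively for the coefficients 1 to 5 of
  l. Degree 5 is enough because a matrix of 2-forms in dimension 11 has vanishing sixth
  power.\<close>

lemma fps_log_nth:
  fixes f :: "complex fps"
  assumes "fps_nth f 0 \<noteq> 0" "fps_nth f 1 = 0" "fps_nth f 3 = 0" "fps_nth f 5 = 0"
  shows "fps_nth (fps_log f) 1 = 0" "fps_nth (fps_log f) 3 = 0" "fps_nth (fps_log f) 5 = 0"
    and "fps_nth (fps_log f) 2 = fps_nth f 2 / fps_nth f 0"
    and "fps_nth (fps_log f) 4 = fps_nth f 4 / fps_nth f 0 - (fps_nth f 2 / fps_nth f 0)\<^sup>2 / 2"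
proof -
  define l where "l = fps_log f"
  have e: "fps_nth (f * fps_deriv l) n = fps_nth (fps_deriv f) n" for n
    using fps_log_deriv[OF assms(1)] by (simp add: l_def)
  have d: "fps_nth (fps_deriv h) 0 = fps_nth h 1" "fps_nth (fps_deriv h) 1 = 2 * fps_nth h 2"
    "fps_nth (fps_deriv h) 2 = 3 * fps_nth h 3" "fps_nth (fps_deriv h) 3 = 4 * fps_nth h 4"
    "fps_nth (fps_deriv h) 4 = 5 * fps_nth h 5" for h :: "complex fps"
    by (simp_all add: numeral_eq_Suc)
  show 1: "fps_nth (fps_log f) 1 = 0"
    using e[of 0] assms by (simp add: d l_def)
  show 2: "fps_nth (fps_log f) 2 = fps_nth f 2 / fps_nth f 0"
    using e[of 1] assms 1 unfolding fps_nth_product_low d by (simp add: l_def field_simps)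
  show 3: "fps_nth (fps_log f) 3 = 0"
    using e[of 2] assms 1 2 unfolding fps_nth_product_low d by (simp add: l_def)
  show 4: "fps_nth (fps_log f) 4 = fps_nth f 4 / fps_nth f 0 - (fps_nth f 2 / fps_nth f 0)\<^sup>2 / 2"
  proof -
    have "fps_nth f 0 * (4 * fps_nth l 4) + fps_nth f 2 * (2 * fps_nth l 2) = 4 * fps_nth f 4"
      using e[of 3] assms 1 2 3 unfolding fps_nth_product_low d by (simp add: l_def)
    then have "fps_nth l 4 = (4 * fps_nth f 4 - fps_nth f 2 * (2 * fps_nth l 2)) / (4 * fps_nth f 0)"
      using assms(1) by (simp add: field_simps)
    then show ?thesis
      using assms(1) unfolding l_def 2 by (simp add: diff_divide_distrib power2_eq_square)
  qed
  show 5: "fps_nth (fps_log f) 5 = 0"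
    using e[of 4] assms 1 2 3 4 unfolding fps_nth_product_low d by (simp add: l_def)
qed

section \<open>Coefficients of the characteristic series of \<open>A_hat\<close> and
  \<open>L_hat\<close>\<close>

lemma fps_sinh_nth: "fps_nth (fps_sinh w) n = (if even n then 0 else w ^ n / fact n)"
  and fps_cosh_nth: "fps_nth (fps_cosh w) n = (if even n then w ^ n / fact n else 0)"
  by (simp_all add: fps_sinh_def fps_cosh_def fps_divide_unit fps_numeral_fps_const
      fps_const_inverse field_simps)

lemma fps_X_over_sinh_nth:
  fixes w :: complex
  assumes "w \<noteq> 0"
  defines "f \<equiv> fps_const w * fps_X / fps_sinh w"
  shows "fps_nth f 0 = 1" "fps_nth f 1 = 0" "fps_nth f 2 = - w\<^sup>2 / 6" "fps_nth f 3 = 0"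
    "fps_nth f 4 = 7 * w ^ 4 / 360" "fps_nth f 5 = 0"
proof -
  have nz: "fps_nth (fps_sinh w) 1 \<noteq> 0" using assms by (simp add: fps_sinh_nth)
  then have "fps_sinh w \<noteq> 0" by auto
  moreover have "subdegree (fps_sinh w) = 1"
    using nz by (intro subdegreeI) (auto simp: fps_sinh_nth)
  \<comment> \<open>The divisor is not a unit, so the quotient can be multiplied back only after
    divisibility is known; both series have order 1.\<close>
  ultimately have "fps_sinh w dvd fps_const w * fps_X"
    using assms by (simp add: fps_dvd_iff)
  then have "f * fps_sinh w = fps_const w * fps_X"
    by (simp add: f_def)
  then have e: "fps_nth (f * fps_sinh w) n = fps_nth (fps_const w * fps_X) n" for n
    by simp
  \<comment> \<open>As \<open>fps_sinh w\<close> starts in degree 1, coefficient n + 1 of the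
    product determines coefficient n of \<open>f\<close>; hence the shift in the uses of
    \<open>e\<close>.\<close>
  note S = fps_nth_product_low fps_sinh_nth
  show 0: "fps_nth f 0 = 1"
    using e[of 1] assms(1) unfolding S by simp
  show 1: "fps_nth f 1 = 0"
    using e[of 2] assms(1) 0 unfolding S by simp
  show 2: "fps_nth f 2 = - w\<^sup>2 / 6"
  proof -
    have "w * (fps_nth f 2 + w\<^sup>2 / 6) = 0"
      using e[of 3] 0 1 unfolding S by (simp add: fact_numeral field_simps power_numeral_reduce)
    then show ?thesis using assms(1) by (simp add: eq_neg_iff_add_eq_0)
  qed
  show 3: "fps_nth f 3 = 0"
    using e[of 4] assms(1) 0 1 2 unfolding S by simp
  show 4: "fps_nth f 4 = 7 * w ^ 4 / 360"
  proof -
    have "w * (fps_nth f 4 - 7 * w ^ 4 / 360) = 0"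
      using e[of 5] 0 1 2 3 unfolding S by (simp add: fact_numeral field_simps power_numeral_reduce)
    then show ?thesis using assms(1) by simp
  qed
  show 5: "fps_nth f 5 = 0"
    using e[of 6] assms(1) 0 1 2 3 4 unfolding S by simp
qed

text \<open>Obtained from the previous series by 2x/tanh x = 2 (x/sinh x) cosh x. The constant term
  2 is the origin of the power 2^(11/2) in \<open>L_hat\<close>.\<close>

lemma fps_X_over_tanh_nth:
  fixes w :: complex
  assumes "w \<noteq> 0"
  defines "f \<equiv> fps_const (2 * w) * fps_X / (fps_sinh w / fps_cosh w)"
  shows "fps_nth f 0 = 2" "fps_nth f 1 = 0" "fps_nth f 2 = 2 * w\<^sup>2 / 3" "fps_nth f 3 = 0"
    "fps_nth f 4 = - 2 * w ^ 4 / 45" "fps_nth f 5 = 0"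
proof -
  define h where "h = fps_const w * fps_X / fps_sinh w"
  note h = fps_X_over_sinh_nth[OF assms(1), folded h_def]
  have c: "fps_nth (fps_cosh w) 0 \<noteq> 0" by (simp add: fps_cosh_nth)
  have nz: "fps_nth (fps_sinh w) 1 \<noteq> 0" using assms by (simp add: fps_sinh_nth)
  then have "fps_sinh w \<noteq> 0" by auto
  moreover have "subdegree (fps_sinh w) = 1"
    using nz by (intro subdegreeI) (auto simp: fps_sinh_nth)
  ultimately have sub: "subdegree (fps_sinh w) = 1" "fps_sinh w \<noteq> 0" by simp_all
  have tanh: "fps_sinh w / fps_cosh w = fps_sinh w * inverse (fps_cosh w)"
    by (rule fps_divide_unit[OF c])
  have unit: "inverse (fps_cosh w) * fps_cosh w = 1" by (rule inverse_mult_eq_1[OF c])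
  have "h * fps_sinh w = fps_const w * fps_X"
    unfolding h_def using assms sub by (intro dvd_div_mult_self) (simp add: fps_dvd_iff)
  then have "fps_const (2 * w) * fps_X = (2 * h * fps_sinh w) * (inverse (fps_cosh w) * fps_cosh w)"
    by (simp add: unit mult.assoc numeral_fps_const fps_const_mult[symmetric] del: fps_const_mult)
  then have "fps_const (2 * w) * fps_X = (2 * (h * fps_cosh w)) * (fps_sinh w / fps_cosh w)"
    by (simp add: tanh mult_ac)
  moreover have "fps_sinh w / fps_cosh w \<noteq> 0"
    using sub c unfolding tanh by simp
  ultimately have "f = 2 * (h * fps_cosh w)"
    by (simp add: f_def)
  then have f: "fps_nth f n = 2 * fps_nth (h * fps_cosh w) n" for n
    by (simp add: numeral_fps_const)
  show "fps_nth f 0 = 2" "fps_nth f 1 = 0" "fps_nth f 2 = 2 * w\<^sup>2 / 3" "fps_nth f 3 = 0"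
    "fps_nth f 4 = - 2 * w ^ 4 / 45" "fps_nth f 5 = 0"
    unfolding f fps_nth_product_low fps_mult_nth_0 fps_cosh_nth h
    by (simp_all add: fact_numeral power_numeral_reduce)
qed

text \<open>With g = X u and u a unit, 1/(k g) is X^(-1) (1/u)/k, which shifts the coefficients by
  one. The term 1/(2X) is purely polar, so the regular part does not see it.\<close>

lemma fls_regpart_pole_difference_nth:
  fixes g :: "complex fps" and k :: complex
  assumes "fps_nth g 0 = 0" "fps_nth g 1 \<noteq> 0"
  shows "fps_nth (fls_regpart (inverse (2 * fls_X) - inverse (fls_const k * fps_to_fls g))) n =
    - fps_nth (inverse (fps_shift 1 g)) (n + 1) / k"
proof -
  define u where "u = fps_shift 1 g"
  have u: "subdegree u = 0" using assms by (simp add: u_def)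
  have "g = fps_X * u"
    using assms(1) by (intro fps_ext) (simp add: u_def fps_X_mult_nth)
  then have "inverse (fls_const k * fps_to_fls g) =
      fls_const (inverse k) * fls_shift 1 (fps_to_fls (inverse u))"
    by (simp add: fls_times_fps_to_fls fls_inverse_const fls_inverse_X fls_X_inv_times_conv_shift
        fls_inverse_fps_to_fls[OF u])
  moreover have "inverse (2 * fls_X) = fls_const (1/2) * (fls_X_inv :: complex fls)"
  proof -
    have two: "(2 :: complex fls) = fls_const 2" by simp
    show ?thesis
      unfolding inverse_mult_distrib fls_inverse_X
      unfolding two fls_inverse_const by (simp only: inverse_eq_divide)
  qed
  ultimately have eq: "fls_regpart (inverse (2 * fls_X) - inverse (fls_const k * fps_to_fls g)) =
      fls_regpart (fls_const (1/2) * fls_X_inv -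
        fls_const (inverse k) * fls_shift 1 (fps_to_fls (inverse u)))"
    by simp
  have "fps_nth (fls_regpart (inverse (2 * fls_X) - inverse (fls_const k * fps_to_fls g))) n =
      - (inverse k * fps_nth (inverse u) (n + 1))"
    unfolding eq by (simp add: nat_add_distrib)
  then show ?thesis
    unfolding u_def by (simp only: divide_inverse mult.commute mult_minus_right)
qed

text \<open>Here b is X/sin(wX), so the numbers are those of x/sin x = 1 + x^2/6 + 7x^4/360 +
  31x^6/15120 + ..., divided by w. Degree 6 is needed because passing to the regular part lowers the
  index by one.\<close>

lemma inverse_shifted_sin_nth:
  fixes w :: complex
  assumes "w \<noteq> 0"
  defines "b \<equiv> inverse (fps_shift 1 (fps_sin w))"
  shows "fps_nth b 0 = 1 / w" "fps_nth b 1 = 0" "fps_nth b 2 = w / 6" "fps_nth b 3 = 0"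
    "fps_nth b 4 = 7 * w ^ 3 / 360" "fps_nth b 5 = 0" "fps_nth b 6 = 31 * w ^ 5 / 15120"
proof -
  define u where "u = fps_shift 1 (fps_sin w)"
  have u: "fps_nth u n = (if even n then (- 1) ^ (n div 2) * w ^ (n + 1) / fact (n + 1) else 0)" for n
    by (simp add: u_def fps_sin_def algebra_simps)
  have "b * u = 1"
    unfolding b_def u_def[symmetric] using assms(1) by (intro inverse_mult_eq_1) (simp add: u)
  then have e: "fps_nth (b * u) n = fps_nth 1 n" for n
    by simp
  have u_low: "fps_nth u 0 = w" "fps_nth u 1 = 0" "fps_nth u 2 = - (w ^ 3) / 6" "fps_nth u 3 = 0"
    "fps_nth u 4 = w ^ 5 / 120" "fps_nth u 5 = 0" "fps_nth u 6 = - (w ^ 7) / 5040"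
    by (simp_all add: u fact_numeral)
  note S = fps_nth_product_low u_low fps_one_nth
  show 0: "fps_nth b 0 = 1 / w"
    using e[of 0] assms(1) by (simp add: u field_simps)
  have inv: "1 / w * w = 1" using assms(1) by simp
  show 1: "fps_nth b 1 = 0"
    using e[of 1] assms(1) 0 unfolding S by simp
  show 2: "fps_nth b 2 = w / 6"
  proof -
    have "1 / w * (- (w ^ 3) / 6) + fps_nth b 2 * w = 0"
      using e[of 2] unfolding S 0 1 by simp
    then show ?thesis using inv by algebra
  qed
  show 3: "fps_nth b 3 = 0"
    using e[of 3] assms(1) 0 1 2 unfolding S by simp
  show 4: "fps_nth b 4 = 7 * w ^ 3 / 360"
  proof -
    have "1 / w * (w ^ 5 / 120) + w / 6 * (- (w ^ 3) / 6) + fps_nth b 4 * w = 0"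
      using e[of 4] unfolding S 0 1 2 3 by simp
    then show ?thesis using inv by algebra
  qed
  show 5: "fps_nth b 5 = 0"
    using e[of 5] assms(1) 0 1 2 3 4 unfolding S by simp
  show 6: "fps_nth b 6 = 31 * w ^ 5 / 15120"
  proof -
    have e6: "1 / w * (- (w ^ 7) / 5040) + w / 6 * (w ^ 5 / 120) + 7 * w ^ 3 / 360 * (- (w ^ 3) / 6) +
        fps_nth b 6 * w = 0"
      using e[of 6] unfolding S 0 1 2 3 4 5 by simp
    have p: "1 / w * (- (w ^ 7) / 5040) = - (w ^ 5 * w) / 5040"
      "w / 6 * (w ^ 5 / 120) = w ^ 5 * w / 720"
      "7 * w ^ 3 / 360 * (- (w ^ 3) / 6) = - 7 * (w ^ 5 * w) / 2160"
      using assms(1) by (simp_all add: power_numeral_reduce)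
    have "fps_nth b 6 * w = 31 * w ^ 5 / 15120 * w"
      using e6 unfolding p by (simp add: field_simps)
    then show ?thesis using assms(1) by simp
  qed
qed

text \<open>In terms of w = 1/(4 pi) the function is 1/(2z) - w/sin(2wz), whence the argument
  \<open>2 * w\<close> and the factor \<open>- w\<close>.\<close>

lemma sin_series_nth:
  defines "w \<equiv> complex_of_real (1 / (4 * pi))"
  shows "fps_nth sin_series 0 = 0" "fps_nth sin_series 1 = - w\<^sup>2 / 3"
    "fps_nth sin_series 2 = 0" "fps_nth sin_series 3 = - 7 * w ^ 4 / 45"
    "fps_nth sin_series 4 = 0" "fps_nth sin_series 5 = - 62 * w ^ 6 / 945"
proof -
  have w: "2 * w \<noteq> 0" by (simp add: w_def)
  have k: "of_real (4 * pi) = 1 / w" and arg: "of_real (1 / (2 * pi)) = 2 * w"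
    by (simp_all add: w_def field_simps)
  have "fps_nth sin_series n = - fps_nth (inverse (fps_shift 1 (fps_sin (2 * w)))) (n + 1) / (1 / w)"
    for n
    unfolding sin_series_def k arg
    by (rule fls_regpart_pole_difference_nth) (use w in simp_all)
  then have S: "fps_nth sin_series n = - w * fps_nth (inverse (fps_shift 1 (fps_sin (2 * w)))) (n + 1)"
    for n
    by simp
  have n: "0 + 1 = (1::nat)" "1 + 1 = (2::nat)" "2 + 1 = (3::nat)" "3 + 1 = (4::nat)"
    "4 + 1 = (5::nat)" "5 + 1 = (6::nat)" by simp_all
  show "fps_nth sin_series 0 = 0" "fps_nth sin_series 1 = - w\<^sup>2 / 3"
    "fps_nth sin_series 2 = 0" "fps_nth sin_series 3 = - 7 * w ^ 4 / 45"
    "fps_nth sin_series 4 = 0" "fps_nth sin_series 5 = - 62 * w ^ 6 / 945"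
    unfolding S n inverse_shifted_sin_nth[OF w] using w
    by (simp_all add: power_numeral_reduce)
qed

text \<open>In terms of w the function is 1/(2z) - (w/2) cot(wz); the cotangent is expanded as the
  cosine times the inverse of the shifted sine series.\<close>

lemma tan_series_nth:
  defines "w \<equiv> complex_of_real (1 / (4 * pi))"
  shows "fps_nth tan_series 0 = 0" "fps_nth tan_series 1 = w\<^sup>2 / 6"
    "fps_nth tan_series 2 = 0" "fps_nth tan_series 3 = w ^ 4 / 90"
    "fps_nth tan_series 4 = 0" "fps_nth tan_series 5 = w ^ 6 / 945"
proof -
  have w: "w \<noteq> 0" by (simp add: w_def)
  have k: "of_real (8 * pi) = 2 / w" and arg: "of_real (1 / (4 * pi)) = w"
    by (simp_all add: w_def field_simps)
  have c: "fps_nth (fps_cos w) 0 \<noteq> 0" by simp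
  have "fps_sin w \<noteq> 0"
  proof
    assume "fps_sin w = 0"
    then have "fps_nth (fps_sin w) (Suc 0) = 0" by simp
    with w show False by (simp only: fps_sin_nth_1)
  qed
  then have sub: "1 \<le> subdegree (fps_sin w)" by (intro subdegree_geI) auto
  have tan: "fps_tan w = fps_sin w * inverse (fps_cos w)"
    unfolding fps_tan_def by (rule fps_divide_unit[OF c])
  have "fps_shift 1 (fps_tan w) = fps_shift 1 (fps_sin w) * inverse (fps_cos w)"
    unfolding tan by (rule fps_shift_mult_right_noncomm) (rule sub)
  then have inv: "inverse (fps_shift 1 (fps_tan w)) = fps_cos w * inverse (fps_shift 1 (fps_sin w))"
    by (simp add: fps_inverse_mult)
  have "fps_nth tan_series n =
      - fps_nth (fps_cos w * inverse (fps_shift 1 (fps_sin w))) (n + 1) / (2 / w)" for n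
    unfolding tan_series_def k arg inv[symmetric]
    by (rule fls_regpart_pole_difference_nth) (use w in \<open>simp_all add: tan fps_nth_mult_expand\<close>)
  then have S: "fps_nth tan_series n =
      - (w / 2) * fps_nth (fps_cos w * inverse (fps_shift 1 (fps_sin w))) (n + 1)" for n
    by simp
  have cos: "fps_nth (fps_cos w) 0 = 1" "fps_nth (fps_cos w) 1 = 0"
    "fps_nth (fps_cos w) 2 = - (w ^ 2) / 2" "fps_nth (fps_cos w) 3 = 0"
    "fps_nth (fps_cos w) 4 = w ^ 4 / 24" "fps_nth (fps_cos w) 5 = 0"
    "fps_nth (fps_cos w) 6 = - (w ^ 6) / 720"
    by (simp_all add: fps_cos_def fact_numeral)
  note T = fps_nth_product_low inverse_shifted_sin_nth[OF w] cos
  have n: "0 + 1 = (1::nat)" "1 + 1 = (2::nat)" "2 + 1 = (3::nat)" "3 + 1 = (4::nat)"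
    "4 + 1 = (5::nat)" "5 + 1 = (6::nat)" by simp_all
  show "fps_nth tan_series 0 = 0" "fps_nth tan_series 1 = w\<^sup>2 / 6"
    "fps_nth tan_series 2 = 0" "fps_nth tan_series 3 = w ^ 4 / 90"
    "fps_nth tan_series 4 = 0" "fps_nth tan_series 5 = w ^ 6 / 945"
    unfolding S n T using w by (simp_all add: field_simps power_numeral_reduce)
qed

section \<open>The identity between transgression forms at a point\<close>

lemma homogeneous_matrix_power:
  fixes R :: "'n::{finite,linorder} exterior^'k^'k"
  assumes "\<And>i j. homogeneous d (R $ i $ j)"
  shows "homogeneous (d * m) (matrix_power R m $ i $ j)"
proof (induction m arbitrary: i j)
  case 0
  show ?case by (auto simp: mat_def intro: homogeneous_one)
next
  case (Suc m)
  show ?case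
    unfolding matrix_power.simps matrix_matrix_mult_def
    by (simp, rule homogeneous_sum, rule homogeneous_mult[OF assms Suc])
qed

lemma homogeneous_trace:
  "(\<And>i j. homogeneous d (B $ i $ j)) \<Longrightarrow> homogeneous d (trace B)"
  by (simp add: trace_def homogeneous_sum)

lemma homogeneous_matrix_mult:
  fixes B C :: "'n::{finite,linorder} exterior^'k^'k"
  assumes "\<And>i j. homogeneous d (B $ i $ j)" "\<And>i j. homogeneous e (C $ i $ j)"
  shows "homogeneous (d + e) ((B ** C) $ i $ j)"
  unfolding matrix_matrix_mult_def
  by (simp, rule homogeneous_sum, rule homogeneous_mult[OF assms])

lemma exp_nilpotent:
  fixes x :: "'a::{real_normed_algebra_1,banach}"
  assumes "x ^ n = 0"
  shows "exp x = (\<Sum>k<n. x ^ k /\<^sub>R fact k)"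
  unfolding exp_def
proof (rule suminf_finite)
  fix k assume "k \<notin> {..<n}"
  then have "x ^ k = x ^ n * x ^ (k - n)" by (simp add: power_add[symmetric])
  then show "x ^ k /\<^sub>R fact k = 0" by (simp add: assms)
qed simp

lemma scaleR_cscale: "r *\<^sub>R cscale z a = cscale (r *\<^sub>R z) a"
  by (simp add: exterior_eq_iff)

lemma cscale_power:
  fixes a :: "'n::{finite,linorder} exterior"
  shows "cscale z a ^ n = cscale (z ^ n) (a ^ n)"
  by (induction n) (simp_all add: cscale_mult cscale_cscale mult.commute)

text \<open>The degree 0 part of the logarithm in \<open>sqrt_det\<close> is not nilpotent, so its
  exponential is a genuine infinite series. It is the image of the complex one under the bounded
  linear map that sends z to z times 1.\<close>

lemma exp_cscale_one:
  "exp (cscale z (1 :: 'n::{finite,linorder} exterior)) = cscale (exp z) 1"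
proof -
  let ?h = "\<lambda>z. cscale z (1 :: 'n exterior)"
  have pow: "?h z ^ n = ?h (z ^ n)" for n
    by (simp add: cscale_power)
  have "(\<lambda>n. ?h (z ^ n /\<^sub>R fact n)) sums ?h (exp z)"
    by (intro bounded_linear.sums[OF bounded_linear_cscale_right] exp_converges)
  then have "(\<lambda>n. ?h z ^ n /\<^sub>R fact n) sums ?h (exp z)"
    unfolding pow by (simp add: scaleR_cscale)
  then show ?thesis
    by (rule sums_unique2[OF exp_converges])
qed

lemma sum_lessThan_6:
  fixes F :: "nat \<Rightarrow> 'a::comm_monoid_add"
  shows "(\<Sum>k<6. F k) = F 0 + F 1 + F 2 + F 3 + F 4 + F 5"
  by (simp add: eval_nat_numeral lessThan_Suc add_ac)

definition power_trace :: "'n::{finite,linorder} exterior^'k^'k \<Rightarrow> nat \<Rightarrow> 'n exterior" where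
  "power_trace R k = trace (matrix_power R k)"

text \<open>For A = d/dt of the connection, (k + 1) tr(A R^k) is the Chern-Simons integrand: its
  exterior derivative is d/dt of tr(R^(k+1)).\<close>

definition transgression_trace ::
  "'n::{finite,linorder} exterior^'k^'k \<Rightarrow> 'n exterior^'k^'k \<Rightarrow> nat \<Rightarrow> 'n exterior" where
  "transgression_trace A R k = trace (A ** matrix_power R k)"

context
  fixes R A :: "'n::{finite,linorder} exterior^'n::{finite,linorder}^'n::{finite,linorder}"
    and c :: "'n::{finite,linorder} exterior"
  assumes dim: "CARD('n::{finite,linorder}) = 11"
    and R: "\<And>i j. homogeneous 2 (R $ i $ j)"
    and A: "\<And>i j. homogeneous 1 (A $ i $ j)"
    and c: "homogeneous 2 c"
begin

section \<open>Degrees of the traces, and reduction of the infinite series to six terms\<close>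

lemma homogeneous_power_trace: "homogeneous (2 * k) (power_trace R k)"
  unfolding power_trace_def by (intro homogeneous_trace homogeneous_matrix_power R)

lemma homogeneous_transgression_trace: "homogeneous (1 + 2 * k) (transgression_trace A R k)"
  unfolding transgression_trace_def
  by (intro homogeneous_trace homogeneous_matrix_mult homogeneous_matrix_power R A)

lemma power_trace_0: "power_trace R 0 = cscale 11 1"
proof -
  have "power_trace R 0 = of_nat CARD('n)"
    by (simp add: power_trace_def trace_def mat_def)
  then show ?thesis by (simp add: dim numeral_mult_eq_cscale[of _ 1, simplified])
qed

text \<open>The entries of R^k have degree 2k, which exceeds 11 from k = 6 on.\<close>

lemma fps_matrix_eq:
  "fps_matrix f R = (\<Sum>k<6. \<chi> i j. cscale (fps_nth f k) (matrix_power R k $ i $ j))"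
  unfolding fps_matrix_def ext_const_mult
proof (rule suminf_finite)
  fix k :: nat assume "k \<notin> {..<6}"
  then have "matrix_power R k $ i $ j = 0" for i j
    by (intro homogeneous_above_top[OF homogeneous_matrix_power[OF R]]) (simp add: dim)
  then show "(\<chi> i j. cscale (fps_nth f k) (matrix_power R k $ i $ j)) = 0"
    by (simp add: vec_eq_iff)
qed simp

lemma trace_fps_matrix: "trace (fps_matrix f R) = (\<Sum>k<6. cscale (fps_nth f k) (power_trace R k))"
  unfolding fps_matrix_eq power_trace_def trace_def cscale_sum
  by (simp add: sum.swap[of _ UNIV])

lemma trace_mult_fps_matrix:
  "trace (A ** fps_matrix f R) = (\<Sum>k<6. cscale (fps_nth f k) (transgression_trace A R k))"
proof -
  have "(A ** fps_matrix f R) $ i $ i = (\<Sum>k<6. cscale (fps_nth f k) ((A ** matrix_power R k) $ i $ i))"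
    for i
    unfolding fps_matrix_eq matrix_matrix_mult_def
    by (simp add: sum_distrib_left cscale_sum cscale_mult sum.swap[of _ UNIV])
  then show ?thesis
    unfolding transgression_trace_def trace_def cscale_sum
    by (simp add: sum.swap[of _ UNIV])
qed

lemma fps_form_eq: "fps_form f c = (\<Sum>k<6. cscale (fps_nth f k) (c ^ k))"
  unfolding fps_form_def ext_const_mult
proof (rule suminf_finite)
  fix k :: nat assume "k \<notin> {..<6}"
  then have "c ^ k = 0"
    by (intro homogeneous_above_top[OF homogeneous_power[OF c]]) (simp add: dim)
  then show "cscale (fps_nth f k) (c ^ k) = 0" by simp
qed simp

text \<open>Since c^6 = 0, the analytic exponential is a polynomial in c. This lets
  \<open>cosh\<close> and \<open>exp\<close> of forms be read off from power series
  coefficients.\<close>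

lemma exp_scaleR_eq_fps_form: "exp (r *\<^sub>R c) = fps_form (fps_exp (of_real r)) c"
proof -
  have "(r *\<^sub>R c) ^ 6 = 0"
    using homogeneous_power[of 2 "r *\<^sub>R c" 6] homogeneous_intros(4)[OF c]
    by (intro homogeneous_above_top[of "2 * 6"]) (auto simp: dim)
  then show ?thesis
    by (simp add: exp_nilpotent fps_form_eq scaleR_power scaleR_eq_cscale cscale_cscale
        cscale_power divide_inverse mult.commute)
qed

section \<open>Homogeneous components of the individual factors\<close>

lemma components4_fps_form:
  assumes "fps_nth f 1 = 0" "fps_nth f 3 = 0" "fps_nth f 5 = 0"
  shows "components4 0 (fps_form f c) (cscale (fps_nth f 0) 1)
    (cscale (fps_nth f 2) (c ^ 2)) (cscale (fps_nth f 4) (c ^ 4))"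
  using assms homogeneous_power[OF c, of 2] homogeneous_power[OF c, of 4]
  unfolding components4_def fps_form_eq sum_lessThan_6
  by (auto intro: homogeneous_one)

text \<open>tr(A R^k) has degree 2k + 1, so an odd series leaves exactly the degrees 3, 7 and
  11.\<close>

lemma components4_trace_mult:
  assumes "fps_nth f 0 = 0" "fps_nth f 2 = 0" "fps_nth f 4 = 0"
  shows "components4 3 (trace (A ** fps_matrix f R)) (cscale (fps_nth f 1) (transgression_trace A R 1))
    (cscale (fps_nth f 3) (transgression_trace A R 3)) (cscale (fps_nth f 5) (transgression_trace A R 5))"
proof -
  have "homogeneous 3 (transgression_trace A R 1)"
    using homogeneous_transgression_trace[of 1] by (simp add: numeral_3_eq_3)
  then show ?thesis
    using assms homogeneous_transgression_trace[of 3] homogeneous_transgression_trace[of 5]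
    unfolding components4_def trace_mult_fps_matrix sum_lessThan_6 by auto
qed

text \<open>For a series that is even up to degree 5, half the trace of the logarithm is a constant
  plus a form y in degrees 4 and 8. The constant exponentiates to \<open>e\<close>, a value of
  f(0)^(11/2) since tr(1) = 11, and exp y = 1 + y + y^2/2; the 8 in the last coefficient comes from
  (l2/2)^2/2.\<close>

lemma components4_sqrt_det:
  fixes f :: "complex fps"
  assumes "fps_nth f 0 \<noteq> 0" "fps_nth f 1 = 0" "fps_nth f 3 = 0" "fps_nth f 5 = 0"
  defines "e \<equiv> exp (11 * ln (fps_nth f 0) / 2)"
    and "l2 \<equiv> fps_nth (fps_log f) 2" and "l4 \<equiv> fps_nth (fps_log f) 4"
  shows "components4 0 (sqrt_det f R) (cscale e 1) (cscale (e * l2 / 2) (power_trace R 2))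
    (cscale (e * l4 / 2) (power_trace R 4) + cscale (e * l2\<^sup>2 / 8) (power_trace R 2 * power_trace R 2))"
proof -
  define y1 where "y1 = cscale (l2 / 2) (power_trace R 2)"
  define y2 where "y2 = cscale (l4 / 2) (power_trace R 4)"
  define y where "y = y1 + y2"
  define e0 where "e0 = cscale (11 * ln (fps_nth f 0) / 2) (1 :: 'n exterior)"
  have y: "components4 0 y 0 y1 y2"
    using homogeneous_power_trace[of 2] homogeneous_power_trace[of 4]
    by (auto simp: components4_def y_def y1_def y2_def)
  have dim': "CARD('n) < 12" by (simp add: dim)
  \<comment> \<open>Each factor y has degree at least 4: the square lives in degree 8 alone and the
    cube would start in degree 12.\<close>
  have yy: "components4 0 (y * y) 0 0 (y1 * y1)"
    using components4_mult[OF y y dim'] by simp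
  have "components4 0 (y * y * y) 0 0 0"
    using components4_mult[OF yy y dim'] by simp
  then have "y ^ 3 = 0"
    by (simp add: components4_def power3_eq_cube)
  then have exp_y: "exp y = 1 + y + (1/2) *\<^sub>R (y * y)"
    by (simp add: exp_nilpotent[of y 3] numeral_eq_Suc)
  have "components4 0 1 (1 :: 'n exterior) 0 0"
    by (auto simp: components4_def intro: homogeneous_one)
  from components4_add[OF components4_add[OF this y] components4_cscale[OF yy, of "1/2"]]
  have exp_y: "components4 0 (exp y) 1 y1 (y2 + cscale (1/2) (y1 * y1))"
    by (simp add: exp_y scaleR_eq_cscale)
  have "trace (fps_matrix (fps_log f) R) /\<^sub>R 2 = e0 + y"
    unfolding trace_fps_matrix sum_lessThan_6 power_trace_0 fps_log_nth(1-3)[OF assms(1-4)]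
      l2_def[symmetric] l4_def[symmetric] fps_log_nth_0 y_def y1_def y2_def e0_def
    unfolding scaleR_eq_cscale by (simp add: exterior_eq_iff field_simps)
  then have "sqrt_det f R = exp (e0 + y)"
    by (simp add: sqrt_det_def)
  also have "\<dots> = exp e0 * exp y"
    by (rule exp_add_commuting) (simp add: e0_def cscale_mult)
  also have "\<dots> = cscale e (exp y)"
    by (simp add: e0_def exp_cscale_one cscale_mult e_def)
  finally have "sqrt_det f R = cscale e (exp y)" .
  then show ?thesis
    using components4_cscale[OF exp_y, of e]
    by (simp add: y1_def y2_def cscale_add cscale_mult cscale_cscale power2_eq_square mult_ac)
qed

lemma components4_L_hat:
  defines "w \<equiv> complex_of_real (1 / (4 * pi))" and "e \<equiv> exp (11 * ln 2 / 2)"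
  shows "components4 0 (L_hat R) (cscale e 1) (cscale (- e * w\<^sup>2 / 6) (power_trace R 2))
    (cscale (- 7 * e * w ^ 4 / 180) (power_trace R 4) +
     cscale (e * w ^ 4 / 72) (power_trace R 2 * power_trace R 2))"
proof -
  \<comment> \<open>\<open>v\<close> is the argument of the hyperbolic series; only its even powers
    occur, so the imaginary unit survives merely as the sign in v^2 = -w^2.\<close>
  define v where "v = \<i> * w"
  have v2: "v\<^sup>2 = - (w\<^sup>2)" by (simp add: v_def power_mult_distrib)
  have "v ^ 4 = (v\<^sup>2)\<^sup>2" by simp
  then have "v ^ 4 = w ^ 4" unfolding v2 by simp
  moreover have "v \<noteq> 0" by (simp add: v_def w_def)
  ultimately have v: "v \<noteq> 0" "v\<^sup>2 = - (w\<^sup>2)" "v ^ 4 = w ^ 4" using v2 by simp_all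
  have args: "\<i> / (4 * of_real pi) = v" "\<i> / (2 * of_real pi) = 2 * v"
    by (simp_all add: v_def w_def field_simps)
  define f where "f = fps_const (2 * v) * fps_X / (fps_sinh v / fps_cosh v)"
  note f = fps_X_over_tanh_nth[OF v(1), folded f_def]
  have l: "fps_nth (fps_log f) 2 = - (w\<^sup>2) / 3" "fps_nth (fps_log f) 4 = - 7 * w ^ 4 / 90"
    using fps_log_nth(4,5)[of f] unfolding f
    by (simp_all add: v power2_eq_square[of "_ / _"] power_divide power_mult[symmetric])
  have "L_hat R = sqrt_det f R"
    unfolding L_hat_def f_def by (simp add: args)
  moreover have q: "e * (- (w\<^sup>2) / 3) / 2 = - e * w\<^sup>2 / 6" "e * (- 7 * w ^ 4 / 90) / 2 = - 7 * e * w ^ 4 / 180"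
    "e * (- (w\<^sup>2) / 3)\<^sup>2 / 8 = e * w ^ 4 / 72"
    by (simp_all add: power_divide power_mult[symmetric])
  moreover have "components4 0 (sqrt_det f R) (cscale e 1) (cscale (e * (- (w\<^sup>2) / 3) / 2) (power_trace R 2))
    (cscale (e * (- 7 * w ^ 4 / 90) / 2) (power_trace R 4) +
     cscale (e * (- (w\<^sup>2) / 3)\<^sup>2 / 8) (power_trace R 2 * power_trace R 2))"
    using components4_sqrt_det[OF _ f(2,4,6), unfolded f l] by (simp add: e_def)
  ultimately show ?thesis unfolding q by simp
qed

lemma components4_A_hat:
  defines "w \<equiv> complex_of_real (1 / (4 * pi))"
  shows "components4 0 (A_hat R) (cscale 1 1) (cscale (w\<^sup>2 / 12) (power_trace R 2))
    (cscale (w ^ 4 / 360) (power_trace R 4) +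
     cscale (w ^ 4 / 288) (power_trace R 2 * power_trace R 2))"
proof -
  define v where "v = \<i> * w"
  have v2: "v\<^sup>2 = - (w\<^sup>2)" by (simp add: v_def power_mult_distrib)
  have "v ^ 4 = (v\<^sup>2)\<^sup>2" by simp
  then have "v ^ 4 = w ^ 4" unfolding v2 by simp
  moreover have "v \<noteq> 0" by (simp add: v_def w_def)
  ultimately have v: "v \<noteq> 0" "v\<^sup>2 = - (w\<^sup>2)" "v ^ 4 = w ^ 4" using v2 by simp_all
  have args: "\<i> / (4 * of_real pi) = v"
    by (simp_all add: v_def w_def field_simps)
  define f where "f = fps_const v * fps_X / fps_sinh v"
  note f = fps_X_over_sinh_nth[OF v(1), folded f_def]
  have l: "fps_nth (fps_log f) 2 = w\<^sup>2 / 6" "fps_nth (fps_log f) 4 = w ^ 4 / 180"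
    using fps_log_nth(4,5)[of f] unfolding f
    by (simp_all add: v power2_eq_square[of "_ / _"] power_divide power_mult[symmetric])
  have "A_hat R = sqrt_det f R"
    unfolding A_hat_def f_def by (simp add: args)
  moreover have q: "1 * (w\<^sup>2 / 6) / 2 = w\<^sup>2 / 12" "1 * (w ^ 4 / 180) / 2 = w ^ 4 / 360"
    "1 * (w\<^sup>2 / 6)\<^sup>2 / 8 = w ^ 4 / 288"
    by (simp_all add: power_divide power_mult[symmetric])
  moreover have "components4 0 (sqrt_det f R) (cscale 1 1) (cscale (1 * (w\<^sup>2 / 6) / 2) (power_trace R 2))
    (cscale (1 * (w ^ 4 / 180) / 2) (power_trace R 4) +
     cscale (1 * (w\<^sup>2 / 6)\<^sup>2 / 8) (power_trace R 2 * power_trace R 2))"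
    using components4_sqrt_det[OF _ f(2,4,6), unfolded f l] by simp
  ultimately show ?thesis unfolding q by simp
qed

lemma components4_cosh: 
  "components4 0 (cosh (c /\<^sub>R 2)) (cscale 1 1) (cscale (1/8) (c ^ 2)) (cscale (1/384) (c ^ 4))"
proof -
  have "cosh (c /\<^sub>R 2) = (exp ((1/2) *\<^sub>R c) + exp ((- 1/2) *\<^sub>R c)) /\<^sub>R 2"
    by (simp add: cosh_def inverse_eq_divide)
  also have "\<dots> = fps_form (fps_cosh (1/2)) c"
    unfolding exp_scaleR_eq_fps_form
    unfolding scaleR_eq_cscale
    by (simp add: fps_form_eq sum_lessThan_6 exterior_eq_iff fps_cosh_nth fact_numeral field_simps)
  finally have "cosh (c /\<^sub>R 2) = fps_form (fps_cosh (1/2)) c" .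
  then show ?thesis
    using components4_fps_form[of "fps_cosh (1/2)"]
    by (simp add: fps_cosh_nth fact_numeral power_numeral_reduce)
qed

lemma components4_exp_sum: 
  "components4 0 (exp c + exp (- c) - 2) 0 (c ^ 2) (cscale (1/12) (c ^ 4))"
proof -
  have "exp c + exp (- c) - 2 = exp (1 *\<^sub>R c) + exp ((- 1) *\<^sub>R c) - cscale 2 1"
    by (simp add: numeral_mult_eq_cscale[of _ 1, simplified])
  also have "\<dots> = fps_form (2 * fps_cosh 1 - 2) c"
    unfolding exp_scaleR_eq_fps_form
    by (simp add: fps_form_eq sum_lessThan_6 exterior_eq_iff fps_cosh_nth fact_numeral
        numeral_fps_const field_simps)
  finally have "exp c + exp (- c) - 2 = fps_form (2 * fps_cosh 1 - 2) c" .
  then show ?thesis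
    using components4_fps_form[of "2 * fps_cosh 1 - 2"]
    by (simp add: fps_cosh_nth fact_numeral numeral_fps_const)
qed

text \<open>The square of cosh(x/2) is (1 + cosh x)/2 = 1 + x^2/4 + x^4/48 + ...; its inverse is
  found from b g = 1 degree by degree.\<close>

lemma components4_inverse_cosh: 
  "components4 0 (fps_form (inverse (fps_cosh (1/2) ^ 2)) c) (cscale 1 1) (cscale (- 1/4) (c ^ 2))
    (cscale (1/24) (c ^ 4))"
proof -
  define g where "g = fps_cosh (1/2) ^ 2"
  define b where "b = inverse g"
  have g: "fps_nth g 0 = 1" "fps_nth g 1 = 0" "fps_nth g 2 = 1/4" "fps_nth g 3 = 0"
    "fps_nth g 4 = 1/48" "fps_nth g 5 = 0"
    unfolding g_def power2_eq_square fps_mult_nth_0 fps_nth_product_low fps_cosh_nth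
    by (simp_all add: fact_numeral power_numeral_reduce)
  have "b * g = 1"
    unfolding b_def using g(1) by (intro inverse_mult_eq_1) simp
  then have e: "fps_nth (b * g) n = fps_nth 1 n" for n
    by simp
  note S = fps_nth_product_low g fps_one_nth
  have 0: "fps_nth b 0 = 1" using e[of 0] by (simp add: g)
  have 1: "fps_nth b 1 = 0" using e[of 1] unfolding S 0 by simp
  have 2: "fps_nth b 2 = - 1/4" using e[of 2] unfolding S 0 1 by (simp add: eq_neg_iff_add_eq_0 add.commute)
  have 3: "fps_nth b 3 = 0" using e[of 3] unfolding S 0 1 2 by simp
  have 4: "fps_nth b 4 = 1/24" using e[of 4] unfolding S 0 1 2 3 by simp
  have 5: "fps_nth b 5 = 0" using e[of 5] unfolding S 0 1 2 3 4 by simp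
  show ?thesis
    using components4_fps_form[OF 1 3 5, unfolded 0 2 4, unfolded b_def g_def] .
qed

text \<open>\<open>E\<close> collects the even and \<open>F\<close> the odd powers of the curvature.
  The components of \<open>F\<close> remain anonymous, since only their degrees, 2 modulo 4, are
  used afterwards.\<close>

lemma chern_character_split:
  defines "w \<equiv> complex_of_real (1 / (4 * pi))"
  obtains E F F0 F1 F2 where "chern_character R = E + F"
    "components4 0 E (cscale 11 1) (cscale (- 2 * w\<^sup>2) (power_trace R 2))
      (cscale (2 * w ^ 4 / 3) (power_trace R 4))"
    "components4 2 F F0 F1 F2"
proof -
  have arg: "\<i> / (2 * of_real pi) = 2 * \<i> * w" by (simp add: w_def field_simps)
  let ?d = "fps_nth (fps_exp (2 * \<i> * w))"
  let ?E = "cscale 11 1 + cscale (- 2 * w\<^sup>2) (power_trace R 2) + cscale (2 * w ^ 4 / 3) (power_trace R 4)"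
  let ?F = "cscale (?d 1) (power_trace R 1) + cscale (?d 3) (power_trace R 3) + cscale (?d 5) (power_trace R 5)"
  have d: "?d 0 = 1" "?d 2 = - 2 * w\<^sup>2" "?d 4 = 2 * w ^ 4 / 3"
    by (simp_all add: power_mult_distrib fact_numeral power4_eq_xxxx)
  have "chern_character R = (\<Sum>k<6. cscale (?d k) (power_trace R k))"
    unfolding chern_character_def trace_fps_matrix by (simp add: arg)
  also have "\<dots> = ?E + ?F"
    unfolding sum_lessThan_6 d power_trace_0 by (simp add: add_ac)
  finally have "chern_character R = ?E + ?F" .
  moreover have "components4 0 ?E (cscale 11 1) (cscale (- 2 * w\<^sup>2) (power_trace R 2))
      (cscale (2 * w ^ 4 / 3) (power_trace R 4))"
    using homogeneous_power_trace[of 2] homogeneous_power_trace[of 4]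
    by (auto simp: components4_def intro: homogeneous_one)
  moreover have "components4 2 ?F (cscale (?d 1) (power_trace R 1)) (cscale (?d 3) (power_trace R 3))
      (cscale (?d 5) (power_trace R 5))"
    using homogeneous_power_trace[of 1] homogeneous_power_trace[of 3] homogeneous_power_trace[of 5]
    by (auto simp: components4_def numeral_2_eq_2)
  ultimately show ?thesis using that by blast
qed

text \<open>With T_k = tr(A R^k) and p_k = tr(R^k), the seven monomials are T_5, T_3 p_2, T_3 c^2,
  T_1 p_4, T_1 p_2^2, T_1 p_2 c^2 and T_1 c^4. For T_5 the identity reads 64 (-62/945) = 8 (11/945 -
  8/15 - 1/315), for T_1 c^4 it reads -64/72 = 8 (-229/2304 - 27/2304), up to powers of w = 1/(4 pi)
  common to both sides.\<close>

lemma degree_11_identity: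
  "degree_part 11 (sqrt 2 *\<^sub>R L_hat R * fps_form (inverse (fps_cosh (1/2) ^ 2)) c *
      trace (A ** fps_matrix sin_series R)) =
    8 *\<^sub>R degree_part 11 (A_hat R * cosh (c /\<^sub>R 2) *
        (chern_character R - 3 * (exp c + exp (- c) - 2)) * trace (A ** fps_matrix tan_series R) +
      A_hat R * cosh (c /\<^sub>R 2) * trace (A ** fps_matrix
        (- fps_const (1 / (2 * pi)) * fps_sin (1 / (2 * pi)) - 3 * tan_series) R))"
proof -
  define w where "w = complex_of_real (1 / (4 * pi))"
  define e where "e = exp (11 * ln 2 / 2 :: complex)"
  have dim': "CARD('n) < 12" by (simp add: dim)
  \<comment> \<open>sqrt 2 times 2^(11/2) is 2^6. The computation is done over the reals; the
    complex logarithm of 2 in \<open>e\<close> agrees with the real one.\<close>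
  have sqrt2e: "complex_of_real (sqrt 2) * e = 64"
  proof -
    have "sqrt 2 * exp (11 * ln 2 / 2) = exp (ln 2 / 2) * exp (11 * ln 2 / 2)"
      by (simp add: powr_half_sqrt[symmetric] powr_def)
    also have "\<dots> = exp (6 * ln 2)" by (simp add: exp_add[symmetric])
    also have "\<dots> = (64 :: real)" by (simp add: exp_of_nat_mult[of 6, simplified])
    finally have "sqrt 2 * exp (11 * ln 2 / 2) = (64 :: real)" .
    moreover have "e = of_real (exp (11 * ln 2 / 2))"
      using Ln_of_real[of 2] by (simp add: e_def exp_of_real[symmetric])
    ultimately show ?thesis by (metis of_real_mult of_real_numeral)
  qed
  \<comment> \<open>Every coefficient of \<open>L_hat\<close> contains the factor \<open>e\<close>,
    so sqrt 2 can be absorbed in each of them; the three instances are the three nonconstant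
    coefficients.\<close>
  have "complex_of_real (sqrt 2) * (z * e * x / y) = 64 * z * x / y" for x y z
    unfolding sqrt2e[symmetric] by simp
  from this[of "- 1" "w\<^sup>2" 6] this[of "- 7" "w ^ 4" 180] this[of 1 "w ^ 4" 72]
  have q: "complex_of_real (sqrt 2) * (- e * w\<^sup>2 / 6) = - 32 * w\<^sup>2 / 3"
    "complex_of_real (sqrt 2) * (- 7 * e * w ^ 4 / 180) = - 112 * w ^ 4 / 45"
    "complex_of_real (sqrt 2) * (e * w ^ 4 / 72) = 8 * w ^ 4 / 9"
    by simp_all
  note sin = sin_series_nth[folded w_def]
  note tan = tan_series_nth[folded w_def]
  let ?s = "- fps_const (1 / (2 * pi)) * fps_sin (1 / (2 * pi)) - 3 * tan_series :: complex fps"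
  have arg: "complex_of_real (1 / (2 * pi)) = 2 * w" by (simp add: w_def)
  \<comment> \<open>In terms of w the series is -2w sin(2wz) minus three times
    \<open>tan_series\<close>; the two contributions to each coefficient are kept apart
    below.\<close>
  have s: "fps_nth ?s n = - 2 * w * fps_nth (fps_sin (2 * w)) n - 3 * fps_nth tan_series n" for n
    unfolding arg by (simp add: numeral_fps_const)
  have s: "fps_nth ?s 0 = 0" "fps_nth ?s 1 = - 4 * w\<^sup>2 - w\<^sup>2 / 2" "fps_nth ?s 2 = 0"
    "fps_nth ?s 3 = 8 * w ^ 4 / 3 - w ^ 4 / 30" "fps_nth ?s 4 = 0"
    "fps_nth ?s 5 = - 8 * w ^ 6 / 15 - w ^ 6 / 315"
    unfolding s tan by (simp_all add: fps_sin_def fact_numeral power_numeral_reduce)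
  \<comment> \<open>This is the one exchange required: p_4 and c^2 cannot occur together in degree
    11, and the transgression trace is already the rightmost factor everywhere.\<close>
  have comm: "c\<^sup>2 * power_trace R 2 = power_trace R 2 * c\<^sup>2"
    using homogeneous_power[OF c, of 2] by (rule even_homogeneous_commute) simp
  have comm: "c\<^sup>2 * power_trace R 2 = power_trace R 2 * c\<^sup>2"
    "c\<^sup>2 * (power_trace R 2 * x) = power_trace R 2 * (c\<^sup>2 * x)" 
    "c\<^sup>2 * c\<^sup>2 = c ^ 4" "c\<^sup>2 * (c\<^sup>2 * x) = c ^ 4 * x" for x
    using comm by (simp_all add: mult.assoc[symmetric] power_add[symmetric])
  note cs = cscale_mult cscale_cscale cscale_add
  have lhs: "components4 0 (sqrt 2 *\<^sub>R L_hat R) (cscale 64 1) 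
    (cscale (- 32 * w\<^sup>2 / 3) (power_trace R 2))
    (cscale (- 112 * w ^ 4 / 45) (power_trace R 4) +
     cscale (8 * w ^ 4 / 9) (power_trace R 2 * power_trace R 2))"
    using components4_cscale[OF components4_L_hat, of "complex_of_real (sqrt 2)", folded w_def e_def]
    unfolding scaleR_eq_cscale cs q by (simp add: sqrt2e)
  have ts: "components4 3 (trace (A ** fps_matrix sin_series R))
    (cscale (- (w\<^sup>2) / 3) (transgression_trace A R 1)) (cscale (- 7 * w ^ 4 / 45) (transgression_trace A R 3))
    (cscale (- 62 * w ^ 6 / 945) (transgression_trace A R 5))"
    using components4_trace_mult[OF sin(1,3,5)] unfolding sin .
  have tt: "components4 3 (trace (A ** fps_matrix tan_series R))
    (cscale (w\<^sup>2 / 6) (transgression_trace A R 1)) (cscale (w ^ 4 / 90) (transgression_trace A R 3))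
    (cscale (w ^ 6 / 945) (transgression_trace A R 5))"
    using components4_trace_mult[OF tan(1,3,5)] unfolding tan .
  have tu: "components4 3 (trace (A ** fps_matrix ?s R))
    (cscale (- 4 * w\<^sup>2 - w\<^sup>2 / 2) (transgression_trace A R 1))
    (cscale (8 * w ^ 4 / 3 - w ^ 4 / 30) (transgression_trace A R 3))
    (cscale (- 8 * w ^ 6 / 15 - w ^ 6 / 315) (transgression_trace A R 5))"
    using components4_trace_mult[OF s(1,3,5)] unfolding s .
  obtain E F F0 F1 F2 where ch: "chern_character R = E + F"
    and E: "components4 0 E (cscale 11 1) (cscale (- 2 * w\<^sup>2) (power_trace R 2))
      (cscale (2 * w ^ 4 / 3) (power_trace R 4))"
    and F: "components4 2 F F0 F1 F2"
    using chern_character_split[folded w_def] by blast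
  have G: "components4 0 (E + cscale (- 3) (exp c + exp (- c) - 2)) (cscale 11 1)
      (cscale (- 2 * w\<^sup>2) (power_trace R 2) + cscale (- 3) (c\<^sup>2))
      (cscale (2 * w ^ 4 / 3) (power_trace R 4) + cscale (- 3) (cscale (1/12) (c ^ 4)))"
    using components4_add[OF E components4_cscale[OF components4_exp_sum, of "- 3"]] by simp
  define G where "G = E + cscale (- 3) (exp c + exp (- c) - 2)"
  note G = G[folded G_def]
  have split: "chern_character R - 3 * (exp c + exp (- c) - 2) = G + F"
    by (simp only: G_def ch numeral_mult_eq_cscale) (simp add: exterior_eq_iff)
  note Ac = components4_mult[OF components4_A_hat[folded w_def] components4_cosh dim']
  \<comment> \<open>The product with \<open>F\<close> has degrees congruent to 0 + 2 + 3 = 5, that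
    is 1 modulo 4, whereas 11 is 3 modulo 4.\<close>
  note odd = degree_part_components4(2)[OF components4_mult[OF components4_mult[OF Ac F dim'] tt dim'], of 11]
  note L3 = degree_part_components4(1)[OF components4_mult[OF components4_mult[OF lhs components4_inverse_cosh dim'] ts dim']]
  note R3 = degree_part_components4(1)[OF components4_mult[OF components4_mult[OF Ac G dim'] tt dim']]
  note S3 = degree_part_components4(1)[OF components4_mult[OF Ac tu dim']]
  have n: "0 + 0 + 0 + 3 + 8 = (11::nat)" "0 + 0 + 3 + 8 = (11::nat)" by simp_all
  have eq: "degree_part 11 (A_hat R * cosh (c /\<^sub>R 2) *
        (chern_character R - 3 * (exp c + exp (- c) - 2)) * trace (A ** fps_matrix tan_series R)) =
     degree_part 11 (A_hat R * cosh (c /\<^sub>R 2) * G * trace (A ** fps_matrix tan_series R))"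
    unfolding split using odd by (simp add: distrib_left distrib_right degree_part_add)
  show ?thesis
    unfolding degree_part_add eq L3[unfolded n] R3[unfolded n] S3[unfolded n]
    unfolding scaleR_eq_cscale
    \<comment> \<open>The first call brings every term to the order power traces, powers of c,
      transgression trace. The second passes to coefficients, where each monomial becomes a complex
      atom and the numerical identities are checked.\<close>
    by (simp add: cs distrib_left distrib_right mult.assoc comm) (simp add: exterior_eq_iff field_simps)
qed

end

section \<open>Smooth functions\<close>

text \<open>Openness is essential: the derivative at x depends on the values near x, and agreement
  on the open set \<open>S\<close> provides a neighbourhood.\<close>

lemma differentiable_times_cong:
  assumes "open S" "\<And>x. x \<in> S \<Longrightarrow> f x = g x" "differentiable_times n S f"
  shows "differentiable_times n S g"
  using assms(2,3)
proof (induction n arbitrary: f g)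
  case 0
  then show ?case using continuous_on_cong[of S S f g] by auto
next
  case (Suc n)
  have d: "(g has_derivative frechet_derivative f (at x)) (at x)" if "x \<in> S" for x
    using Suc.prems that assms(1)
    by (auto simp: frechet_derivative_works intro: has_derivative_transform_within_open[of f _ x UNIV S])
  then have "frechet_derivative g (at x) = frechet_derivative f (at x)" if "x \<in> S" for x
    using that frechet_derivative_at by fastforce
  then have "differentiable_times n S (\<lambda>x. frechet_derivative g (at x) v)" for v
    using Suc.IH[of "\<lambda>x. frechet_derivative f (at x) v" "\<lambda>x. frechet_derivative g (at x) v"]
      Suc.prems(2) by auto
  then show ?case
    using d by (auto simp: differentiable_def)
qed

lemma differentiable_times_subset:
  "differentiable_times n S f \<Longrightarrow> T \<subseteq> S \<Longrightarrow> differentiable_times n T f"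
  by (induction n arbitrary: f) (auto intro: continuous_on_subset)

lemma differentiable_times_SucD: "differentiable_times (Suc n) S f \<Longrightarrow> differentiable_times n S f"
proof (induction n arbitrary: f)
  case 0
  then show ?case
    by (auto intro!: continuous_at_imp_continuous_on differentiable_imp_continuous_within)
qed auto

text \<open>Allows an explicit derivative to stand in for the one chosen by
  \<open>frechet_derivative\<close>; all the inductions below go through it.\<close>

lemma differentiable_times_SucI:
  assumes "open S"
    and "\<And>x. x \<in> S \<Longrightarrow> (f has_derivative f' x) (at x)"
    and "\<And>v. differentiable_times n S (\<lambda>x. f' x v)"
  shows "differentiable_times (Suc n) S f"
proof -
  have "frechet_derivative f (at x) = f' x" if "x \<in> S" for x
    using assms(2)[OF that] frechet_derivative_at by metis
  then have "differentiable_times n S (\<lambda>x. frechet_derivative f (at x) v)" for v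
    by (intro differentiable_times_cong[OF assms(1) _ assms(3)[of v]]) simp
  then show ?thesis
    using assms(2) by (auto simp: differentiable_def)
qed

lemma differentiable_times_const: "open S \<Longrightarrow> differentiable_times n S (\<lambda>x. c)"
proof (induction n arbitrary: c)
  case (Suc n)
  show ?case
    by (rule differentiable_times_SucI[OF Suc.prems has_derivative_const Suc.IH[OF Suc.prems]])
qed simp

lemma differentiable_times_add:
  assumes "open S" "differentiable_times n S f" "differentiable_times n S g"
  shows "differentiable_times n S (\<lambda>x. f x + g x)"
  using assms(2,3)
proof (induction n arbitrary: f g)
  case 0
  then show ?case by (auto intro: continuous_on_add)
next
  case (Suc n)
  show ?case
  proof (rule differentiable_times_SucI[OF assms(1)])
    show "((\<lambda>x. f x + g x) has_derivative
        (\<lambda>v. frechet_derivative f (at x) v + frechet_derivative g (at x) v)) (at x)" if "x \<in> S" for x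
      using Suc.prems that by (intro has_derivative_add) (auto simp: frechet_derivative_works)
  qed (use Suc in auto)
qed

lemma differentiable_times_sum:
  assumes "open S" "\<And>i. i \<in> I \<Longrightarrow> differentiable_times n S (f i)"
  shows "differentiable_times n S (\<lambda>x. \<Sum>i\<in>I. f i x)"
  using assms(2)
  by (induction I rule: infinite_finite_induct)
    (auto simp: differentiable_times_const[OF assms(1)] intro: differentiable_times_add[OF assms(1)])

lemma differentiable_times_bounded_linear:
  assumes "open S" "bounded_linear h" "differentiable_times n S f"
  shows "differentiable_times n S (\<lambda>x. h (f x))"
  using assms(3)
proof (induction n arbitrary: f)
  case 0
  then show ?case by (auto intro: bounded_linear.continuous_on[OF assms(2)])
next
  case (Suc n)
  show ?case
  proof (rule differentiable_times_SucI[OF assms(1)])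
    show "((\<lambda>x. h (f x)) has_derivative (\<lambda>v. h (frechet_derivative f (at x) v))) (at x)"
      if "x \<in> S" for x
      using Suc.prems that
      by (intro bounded_linear.has_derivative[OF assms(2)]) (auto simp: frechet_derivative_works)
  qed (use Suc in auto)
qed

lemma differentiable_times_scaleR:
  assumes "open S" "differentiable_times n S f" "differentiable_times n S g"
  shows "differentiable_times n S (\<lambda>x. f x *\<^sub>R g x)"
  using assms(2,3)
proof (induction n arbitrary: f g)
  case 0
  then show ?case by (auto intro: continuous_on_scaleR)
next
  case (Suc n)
  show ?case
  proof (rule differentiable_times_SucI[OF assms(1)])
    show "((\<lambda>x. f x *\<^sub>R g x) has_derivative
        (\<lambda>v. f x *\<^sub>R frechet_derivative g (at x) v + frechet_derivative f (at x) v *\<^sub>R g x)) (at x)"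
      if "x \<in> S" for x
      using Suc.prems that by (intro has_derivative_scaleR) (auto simp: frechet_derivative_works)
    show "differentiable_times n S
        (\<lambda>x. f x *\<^sub>R frechet_derivative g (at x) v + frechet_derivative f (at x) v *\<^sub>R g x)" for v
      using Suc.prems differentiable_times_SucD[OF Suc.prems(1)] differentiable_times_SucD[OF Suc.prems(2)]
      by (intro differentiable_times_add[OF assms(1)] Suc.IH) simp_all
  qed
qed

text \<open>In the chain rule derivative f'(g x)(g'(x) v) the direction varies with x, so the
  induction hypothesis does not apply directly. Expanding g'(x) v in a basis turns it into a sum of
  scalar functions times f'(g x) b with fixed b; this is why g takes values in a Euclidean
  space.\<close>

lemma differentiable_times_compose:
  fixes g :: "'a::real_normed_vector \<Rightarrow> 'b::euclidean_space"
  assumes "open S" "open T" "g ` S \<subseteq> T" "differentiable_times n T f" "differentiable_times n S g"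
  shows "differentiable_times n S (\<lambda>x. f (g x))"
  using assms(4,5)
proof (induction n arbitrary: f)
  case 0
  then show ?case using continuous_on_compose2[of T f S g] assms(3) by auto
next
  case (Suc n)
  let ?f' = "\<lambda>x. frechet_derivative f (at x)" and ?g' = "\<lambda>x. frechet_derivative g (at x)"
  show ?case
  proof (rule differentiable_times_SucI[OF assms(1)])
    fix x assume x: "x \<in> S"
    then have f: "(f has_derivative ?f' (g x)) (at (g x))" and g: "(g has_derivative ?g' x) (at x)"
      using Suc.prems assms(3) by (auto simp: frechet_derivative_works)
    have D: "((\<lambda>x. f (g x)) has_derivative (\<lambda>v. ?f' (g x) (?g' x v))) (at x)"
      using diff_chain_at[OF g f] by (simp add: o_def)
    have "?f' (g x) w = (\<Sum>b\<in>Basis. (w \<bullet> b) *\<^sub>R ?f' (g x) b)" for w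
    proof -
      interpret bounded_linear "?f' (g x)" using f by (rule has_derivative_bounded_linear)
      show ?thesis
        by (subst euclidean_representation[of w, symmetric]) (simp add: sum scaleR del: euclidean_representation)
    qed
    then have eq: "(\<lambda>v. ?f' (g x) (?g' x v)) =
        (\<lambda>v. \<Sum>b\<in>Basis. (?g' x v \<bullet> b) *\<^sub>R ?f' (g x) b)"
      by (rule ext)
    show "((\<lambda>x. f (g x)) has_derivative
        (\<lambda>v. \<Sum>b\<in>Basis. (?g' x v \<bullet> b) *\<^sub>R ?f' (g x) b)) (at x)"
      using D unfolding eq .
  next
    fix v
    show "differentiable_times n S (\<lambda>x. \<Sum>b\<in>Basis. (?g' x v \<bullet> b) *\<^sub>R ?f' (g x) b)"
      using Suc.prems differentiable_times_SucD[OF Suc.prems(2)]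
      by (intro differentiable_times_sum differentiable_times_scaleR assms(1)
          differentiable_times_bounded_linear[OF assms(1) bounded_linear_inner_left] Suc.IH)
        simp_all
  qed
qed

lemma smooth_on_cong: "open S \<Longrightarrow> (\<And>x. x \<in> S \<Longrightarrow> f x = g x) \<Longrightarrow> smooth_on S f \<Longrightarrow> smooth_on S g"
  unfolding smooth_on_def using differentiable_times_cong by blast

lemma smooth_on_subset: "smooth_on S f \<Longrightarrow> T \<subseteq> S \<Longrightarrow> smooth_on T f"
  unfolding smooth_on_def using differentiable_times_subset by blast

lemma smooth_on_const: "open S \<Longrightarrow> smooth_on S (\<lambda>x. c)"
  by (simp add: smooth_on_def differentiable_times_const)

lemma smooth_on_add: "open S \<Longrightarrow> smooth_on S f \<Longrightarrow> smooth_on S g \<Longrightarrow> smooth_on S (\<lambda>x. f x + g x)"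
  by (simp add: smooth_on_def differentiable_times_add)

lemma smooth_on_mult:
  fixes f g :: "'a::real_normed_vector \<Rightarrow> real"
  shows "open S \<Longrightarrow> smooth_on S f \<Longrightarrow> smooth_on S g \<Longrightarrow> smooth_on S (\<lambda>x. f x * g x)"
  using differentiable_times_scaleR[of S _ f g] by (simp add: smooth_on_def)

lemma smooth_on_vec_nth:
  fixes f :: "'a::real_normed_vector \<Rightarrow> real^'n"
  shows "open S \<Longrightarrow> smooth_on S f \<Longrightarrow> smooth_on S (\<lambda>x. f x $ i)"
  unfolding smooth_on_def
  using differentiable_times_bounded_linear[OF _ bounded_linear_vec_nth] by blast

lemma smooth_on_frechet_derivative: "smooth_on S f \<Longrightarrow> smooth_on S (\<lambda>x. frechet_derivative f (at x) v)"
  unfolding smooth_on_def by (metis differentiable_times.simps(2))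

lemma smooth_on_differentiable: "smooth_on S f \<Longrightarrow> x \<in> S \<Longrightarrow> f differentiable (at x)"
  unfolding smooth_on_def by (metis differentiable_times.simps(2))

lemma smooth_on_compose:
  fixes g :: "'a::real_normed_vector \<Rightarrow> 'b::euclidean_space"
  shows "open S \<Longrightarrow> open T \<Longrightarrow> g ` S \<subseteq> T \<Longrightarrow> smooth_on T f \<Longrightarrow> smooth_on S g \<Longrightarrow>
    smooth_on S (\<lambda>x. f (g x))"
  unfolding smooth_on_def using differentiable_times_compose by blast

section \<open>Coordinate vector fields and paths of connections\<close>

context
  fixes M :: "('m::{t2_space,second_countable_topology}, 'n::finite) atlas"
  assumes M: "smooth_manifold M"
begin

section \<open>Charts and smooth functions on the manifold\<close>

lemma chart:
  assumes "(U, \<phi>) \<in> M"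
  shows "open U" "open (\<phi> ` U)" "homeomorphism U (\<phi> ` U) \<phi> (inv_into U \<phi>)"
  using M assms unfolding smooth_manifold_def by blast+

lemma chart_inv: "(U, \<phi>) \<in> M \<Longrightarrow> q \<in> U \<Longrightarrow> inv_into U \<phi> (\<phi> q) = q"
  using chart(3) homeomorphism_apply1 by blast

lemma chart_open_image:
  assumes "(U, \<phi>) \<in> M" "open W"
  shows "open (\<phi> ` (U \<inter> W))"
proof -
  have "openin (top_of_set (\<phi> ` U)) (\<phi> ` (U \<inter> W))"
    using assms(2) by (intro homeomorphism_imp_open_map[OF chart(3)[OF assms(1)]]) auto
  then show ?thesis
    using openin_open_trans chart(2)[OF assms(1)] by blast
qed

lemma transition_smooth:
  "(U, \<phi>) \<in> M \<Longrightarrow> (V, \<psi>) \<in> M \<Longrightarrow> smooth_on (\<phi> ` (U \<inter> V)) (\<psi> \<circ> inv_into U \<phi>)"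
  using M unfolding smooth_manifold_def by blast

lemma smooth_fun_cong:
  assumes "smooth_fun M W f" "open W'" "W' \<subseteq> W" "\<And>q. q \<in> W' \<Longrightarrow> f q = g q"
  shows "smooth_fun M W' g"
  unfolding smooth_fun_def
proof (intro conjI ballI, fact, clarify)
  fix U \<phi> assume U: "(U, \<phi>) \<in> M"
  have "smooth_on (\<phi> ` (U \<inter> W')) (f \<circ> inv_into U \<phi>)"
    using assms(1,3) U unfolding smooth_fun_def by (blast intro: smooth_on_subset)
  then show "smooth_on (\<phi> ` (U \<inter> W')) (g \<circ> inv_into U \<phi>)"
    by (rule smooth_on_cong[OF chart_open_image[OF U assms(2)], rotated])
      (auto simp: chart_inv[OF U] assms(4))
qed

lemma smooth_fun_const: "open W \<Longrightarrow> smooth_fun M W (\<lambda>q. r)"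
  unfolding smooth_fun_def by (auto simp: o_def intro!: smooth_on_const chart_open_image)

lemma smooth_fun_add: "smooth_fun M W f \<Longrightarrow> smooth_fun M W g \<Longrightarrow> smooth_fun M W (\<lambda>q. f q + g q)"
  unfolding smooth_fun_def by (fastforce simp: o_def intro!: smooth_on_add chart_open_image)

lemma smooth_fun_mult: "smooth_fun M W f \<Longrightarrow> smooth_fun M W g \<Longrightarrow> smooth_fun M W (\<lambda>q. f q * g q)"
  unfolding smooth_fun_def by (fastforce simp: o_def intro!: smooth_on_mult chart_open_image)

lemma smooth_near_const: "smooth_near M p (\<lambda>q. r)"
  unfolding smooth_near_def using smooth_fun_const[OF open_UNIV] by blast

lemma smooth_near_binop:
  assumes op: "\<And>W f g. smooth_fun M W f \<Longrightarrow> smooth_fun M W g \<Longrightarrow> smooth_fun M W (\<lambda>q. h (f q) (g q))"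
    and "smooth_near M p f" "smooth_near M p g"
  shows "smooth_near M p (\<lambda>q. h (f q) (g q))"
proof -
  obtain W W' where W: "p \<in> W" "p \<in> W'" "smooth_fun M W f" "smooth_fun M W' g"
    using assms(2,3) unfolding smooth_near_def by blast
  then have "open (W \<inter> W')" unfolding smooth_fun_def by auto
  then have "smooth_fun M (W \<inter> W') f" "smooth_fun M (W \<inter> W') g"
    using smooth_fun_cong W(3,4) by (metis inf_le1, metis inf_le2)
  then show ?thesis
    unfolding smooth_near_def using W(1,2) op by blast
qed

lemma smooth_near_add:
  "smooth_near M p f \<Longrightarrow> smooth_near M p g \<Longrightarrow> smooth_near M p (\<lambda>q. f q + g q)"
  by (rule smooth_near_binop[where h = "(+)"]) (auto intro: smooth_fun_add)

lemma smooth_near_mult: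
  "smooth_near M p f \<Longrightarrow> smooth_near M p g \<Longrightarrow> smooth_near M p (\<lambda>q. f q * g q)"
  by (rule smooth_near_binop[where h = "(*)"]) (auto intro: smooth_fun_mult)

lemma smooth_near_cong:
  assumes "smooth_near M p f" "open W" "p \<in> W" "\<And>q. q \<in> W \<Longrightarrow> f q = g q"
  shows "smooth_near M p g"
proof -
  obtain W' where W': "p \<in> W'" "smooth_fun M W' f"
    using assms(1) unfolding smooth_near_def by blast
  then have "open (W \<inter> W')" using assms(2) unfolding smooth_fun_def by auto
  then have "smooth_fun M (W \<inter> W') g"
    using assms(4) by (intro smooth_fun_cong[OF W'(2)]) auto
  then show ?thesis using assms(3) W'(1) unfolding smooth_near_def by blast
qed

lemma smooth_near_differentiable:
  assumes "(U, \<phi>) \<in> M" "p \<in> U" "smooth_near M p f"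
  shows "(f \<circ> inv_into U \<phi>) differentiable (at (\<phi> p))"
proof -
  obtain W where "p \<in> W" "smooth_fun M W f"
    using assms(3) unfolding smooth_near_def by blast
  then show ?thesis
    using assms(1,2) unfolding smooth_fun_def by (blast intro: smooth_on_differentiable)
qed

text \<open>In the chart this is a partial derivative, so the algebraic laws are those of the
  Frechet derivative. The delicate clause is locality, which must also hold for functions that are
  not smooth near p.\<close>

lemma coord_field_derivation:
  assumes U: "(U, \<phi>) \<in> M" and p: "p \<in> U"
  shows "derivation_at M p (snd (coord_field M U \<phi> j p))"
proof -
  let ?d = "\<lambda>f. frechet_derivative (f \<circ> inv_into U \<phi>) (at (\<phi> p)) (axis j 1)"
  note diff = smooth_near_differentiable[OF U p]
  have D: "((\<lambda>x. f (inv_into U \<phi> x)) has_derivative frechet_derivative (f \<circ> inv_into U \<phi>) (at (\<phi> p))) (at (\<phi> p))"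
    if "smooth_near M p f" for f
    using diff[OF that] by (simp add: frechet_derivative_works o_def)
  have local: "?d f = ?d g" "smooth_near M p g"
    if f: "smooth_near M p f" and W: "open W" "p \<in> W" "\<forall>q\<in>W. f q = g q" for f g W
  proof -
    show "smooth_near M p g" using smooth_near_cong f W by blast
    have "(f \<circ> inv_into U \<phi>) x = (g \<circ> inv_into U \<phi>) x" if "x \<in> \<phi> ` (U \<inter> W)" for x
      using that W(3) by (auto simp: chart_inv[OF U])
    then have "(g \<circ> inv_into U \<phi> has_derivative frechet_derivative (f \<circ> inv_into U \<phi>) (at (\<phi> p))) (at (\<phi> p))"
      using has_derivative_transform_within_open[OF _ chart_open_image[OF U W(1)], of "f \<circ> inv_into U \<phi>" _ _ UNIV]
        diff[OF f] p W(2) by (auto simp: frechet_derivative_works)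
    then show "?d f = ?d g"
      using frechet_derivative_at by metis
  qed
  have inv: "inv_into U \<phi> (\<phi> p) = p" by (rule chart_inv[OF U p])
  have add: "?d (\<lambda>q. f q + g q) = ?d f + ?d g" if "smooth_near M p f" "smooth_near M p g" for f g
    using frechet_derivative_at[OF has_derivative_add[OF D[OF that(1)] D[OF that(2)]], symmetric]
    by (simp add: o_def)
  have mult: "?d (\<lambda>q. f q * g q) = ?d f * g p + f p * ?d g" if "smooth_near M p f" "smooth_near M p g" for f g
    using frechet_derivative_at[OF has_derivative_mult[OF D[OF that(1)] D[OF that(2)]], symmetric]
    by (simp add: o_def inv)
  have scale: "?d (\<lambda>q. r * f q) = r * ?d f" if "smooth_near M p f" for f r
    using frechet_derivative_at[OF has_derivative_mult_right[OF D[OF that]], symmetric]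
    by (simp add: o_def)
  \<comment> \<open>Smoothness near p is itself a property of the germ; hence the default value 0 is
    taken for both functions or for neither.\<close>
  have "smooth_near M p f \<longleftrightarrow> smooth_near M p g"
    if "open W" "p \<in> W" "\<forall>q\<in>W. f q = g q" for f g W
    using local(2)[of f W g] local(2)[of g W f] that by auto
  then show ?thesis
    unfolding derivation_at_def coord_field_def snd_conv
    using local(1) add mult scale
    by (auto simp: smooth_near_add smooth_near_mult smooth_near_const smooth_near_mult[OF smooth_near_const])
qed

section \<open>The coordinate frame as smooth sections of the tangent bundle\<close>

lemma fibre_tangent_bundle:
  "e \<in> fibre (tangent_bundle M) p \<longleftrightarrow> fst e = p \<and> derivation_at M p (snd e)"
  by (cases e) (auto simp: fibre_def tangent_bundle_def)

lemma coord_field_in_fibre: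
  "(U, \<phi>) \<in> M \<Longrightarrow> p \<in> U \<Longrightarrow> coord_field M U \<phi> j p \<in> fibre (tangent_bundle M) p"
  using coord_field_derivation by (simp add: fibre_tangent_bundle) (simp add: coord_field_def)

lemma smooth_sectionI:
  assumes "open W" "\<And>q. q \<in> W \<Longrightarrow> s q \<in> fibre (tangent_bundle M) q"
    and "\<And>V \<psi> i. (V, \<psi>) \<in> M \<Longrightarrow> smooth_fun M (V \<inter> W) (\<lambda>q. components \<psi> (s q) $ i)"
  shows "smooth_section M (tangent_bundle M) W s"
proof -
  have "trivs (tangent_bundle M) = {(U, components \<phi>) | U \<phi>. (U, \<phi>) \<in> M}"
    by (simp add: tangent_bundle_def)
  then show ?thesis
    unfolding smooth_section_def by (auto intro: assms)
qed

text \<open>In a chart \<open>\<psi>\<close> the components of the coordinate field of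
  \<open>\<phi>\<close> form a column of the Jacobian of the transition map from
  \<open>\<phi>\<close> to \<open>\<psi>\<close>, and derivatives of smooth maps are smooth.\<close>

lemma smooth_coord_field:
  assumes U: "(U, \<phi>) \<in> M"
  shows "smooth_section M (tangent_bundle M) U (coord_field M U \<phi> j)"
proof -
  have "smooth_fun M (V \<inter> U) (\<lambda>q. components \<psi> (coord_field M U \<phi> j q) $ i)" if V: "(V, \<psi>) \<in> M" for V \<psi> i
  proof -
    let ?h = "(\<lambda>q. \<psi> q $ i) \<circ> inv_into U \<phi>"
    have coordinate: "smooth_fun M V (\<lambda>q. \<psi> q $ i)"
      unfolding smooth_fun_def
    proof (intro conjI ballI, rule chart(1)[OF V], clarify)
      fix X \<theta> assume X: "(X, \<theta>) \<in> M"
      show "smooth_on (\<theta> ` (X \<inter> V)) ((\<lambda>q. \<psi> q $ i) \<circ> inv_into X \<theta>)"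
        using smooth_on_vec_nth[OF chart_open_image[OF X chart(1)[OF V]] transition_smooth[OF X V]]
        by (simp add: o_def)
    qed
    \<comment> \<open>Without this the coordinate field would be evaluated to its default 0 on the
      coordinate functions.\<close>
    then have near: "smooth_near M q (\<lambda>q. \<psi> q $ i)" if "q \<in> V" for q
      using that unfolding smooth_near_def by blast
    have dom: "open (\<phi> ` (U \<inter> V))" by (rule chart_open_image[OF U chart(1)[OF V]])
    have "smooth_on (\<phi> ` (U \<inter> V)) ?h"
      using coordinate U unfolding smooth_fun_def by blast
    then have dh: "smooth_on (\<phi> ` (U \<inter> V)) (\<lambda>y. frechet_derivative ?h (at y) (axis j 1))"
      by (rule smooth_on_frechet_derivative)
    have VU: "open (V \<inter> U)" using chart(1) U V by blast
    show ?thesis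
      unfolding smooth_fun_def
    proof (intro conjI ballI, rule VU, clarify)
      \<comment> \<open>Smoothness is tested in every chart, so the Jacobian entry, given in the
        coordinates of \<open>\<phi>\<close>, is composed with the transition from a third chart
        \<open>\<theta>\<close> to \<open>\<phi>\<close>.\<close>
      fix X \<theta> assume X: "(X, \<theta>) \<in> M"
      have op: "open (\<theta> ` (X \<inter> (V \<inter> U)))" by (rule chart_open_image[OF X VU])
      have "smooth_on (\<theta> ` (X \<inter> (V \<inter> U))) (\<phi> \<circ> inv_into X \<theta>)"
        using transition_smooth[OF X U] by (rule smooth_on_subset) auto
      moreover have "(\<phi> \<circ> inv_into X \<theta>) ` \<theta> ` (X \<inter> (V \<inter> U)) \<subseteq> \<phi> ` (U \<inter> V)"
        by (auto simp: chart_inv[OF X])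
      ultimately have "smooth_on (\<theta> ` (X \<inter> (V \<inter> U)))
          (\<lambda>x. frechet_derivative ?h (at ((\<phi> \<circ> inv_into X \<theta>) x)) (axis j 1))"
        by (intro smooth_on_compose[OF op dom _ dh])
      then show "smooth_on (\<theta> ` (X \<inter> (V \<inter> U)))
          ((\<lambda>q. components \<psi> (coord_field M U \<phi> j q) $ i) \<circ> inv_into X \<theta>)"
        by (rule smooth_on_cong[OF op, rotated])
          (auto simp: chart_inv[OF X] components_def coord_field_def near)
    qed
  qed
  from smooth_sectionI[OF chart(1)[OF U] coord_field_in_fibre[OF U] this] show ?thesis .
qed

text \<open>The Leibniz rule for 1 = 1 times 1 gives v(1) = 2 v(1), hence v(1) = 0; homogeneity does
  the rest.\<close>

lemma derivation_const:
  assumes "derivation_at M p v"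
  shows "v (\<lambda>q. r) = 0"
proof -
  note derivation = assms[unfolded derivation_at_def, THEN conjunct2, THEN conjunct2]
  note const = smooth_near_const[of p]
  have "v (\<lambda>q. 1) = 0"
    using derivation[THEN conjunct1, rule_format, OF conjI[OF const[of 1] const[of 1]]] by simp
  then show ?thesis
    using derivation[THEN conjunct2, rule_format, OF const[of 1], of r] by simp
qed

lemma derivation_scale:
  assumes "derivation_at M p v"
  shows "derivation_at M p (\<lambda>f. r * v f)"
  using assms unfolding derivation_at_def
  by (simp add: algebra_simps)

lemma smooth_section_scale:
  assumes "smooth_section M (tangent_bundle M) W s"
  shows "smooth_section M (tangent_bundle M) W (\<lambda>q. fib_scale (tangent_bundle M) r (s q))"
proof -
  have W: "open W" using assms by (simp add: smooth_section_def)
  have smooth: "smooth_fun M (V \<inter> W) (\<lambda>q. components \<psi> (fib_scale (tangent_bundle M) r (s q)) $ i)"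
    if V: "(V, \<psi>) \<in> M" for V \<psi> i
  proof -
    have "open (V \<inter> W)" using chart(1)[OF V] W by blast
    moreover have "smooth_fun M (V \<inter> W) (\<lambda>q. components \<psi> (s q) $ i)"
      using assms V by (force simp: smooth_section_def tangent_bundle_def)
    ultimately show ?thesis
      using smooth_fun_mult[OF smooth_fun_const] by (simp add: components_def tangent_bundle_def)
  qed
  have fibre: "fib_scale (tangent_bundle M) r (s q) \<in> fibre (tangent_bundle M) q" if "q \<in> W" for q
    using assms that derivation_scale
    by (auto simp: smooth_section_def fibre_tangent_bundle) (auto simp: tangent_bundle_def)
  show ?thesis by (rule smooth_sectionI[OF W fibre smooth])
qed

text \<open>Homogeneity under real scalars is the Leibniz rule for a constant function, whose
  derivative term vanishes. The smoothness assumptions are forced by the axioms, which constrain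
  \<open>D\<close> on smooth sections.\<close>

lemma connection_linear:
  fixes r0 r1 :: real
  assumes D: "connection M (tangent_bundle M) D"
    and s: "smooth_section M (tangent_bundle M) W s0" "smooth_section M (tangent_bundle M) W s1"
    and v: "p \<in> W" "v \<in> fibre (tangent_bundle M) p"
  shows "snd (D (\<lambda>q. fib_add (tangent_bundle M) (fib_scale (tangent_bundle M) r0 (s0 q))
      (fib_scale (tangent_bundle M) r1 (s1 q))) v) f = r0 * snd (D s0 v) f + r1 * snd (D s1 v) f"
proof -
  have pointwise: "(\<forall>s'. smooth_section M (tangent_bundle M) W s' \<longrightarrow>
        D (\<lambda>q. fib_add (tangent_bundle M) (s q) (s' q)) v = fib_add (tangent_bundle M) (D s v) (D s' v)) \<and>
      (\<forall>f. smooth_fun M W f \<longrightarrow> D (\<lambda>q. fib_scale (tangent_bundle M) (f q) (s q)) v =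
        fib_add (tangent_bundle M) (fib_scale (tangent_bundle M) (snd v f) (s p))
          (fib_scale (tangent_bundle M) (f p) (D s v)))"
    if "smooth_section M (tangent_bundle M) W s" for s
    using D[unfolded connection_def, rule_format, OF that, THEN conjunct1, rule_format, OF v]
    by (elim conjE) (intro conjI)
  have scale: "snd (D (\<lambda>q. fib_scale (tangent_bundle M) r (s q)) v) f = r * snd (D s v) f"
    if s: "smooth_section M (tangent_bundle M) W s" for r s
  proof -
    have "smooth_fun M W (\<lambda>q. r)"
      using s smooth_fun_const by (simp add: smooth_section_def)
    then have "D (\<lambda>q. fib_scale (tangent_bundle M) r (s q)) v =
        fib_add (tangent_bundle M) (fib_scale (tangent_bundle M) (snd v (\<lambda>q. r)) (s p))
          (fib_scale (tangent_bundle M) r (D s v))"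
      by (rule pointwise[OF s, THEN conjunct2, rule_format])
    moreover have "snd v (\<lambda>q. r) = 0"
      using v(2) derivation_const by (auto simp: fibre_tangent_bundle)
    ultimately show ?thesis by (simp add: tangent_bundle_def)
  qed
  have "D (\<lambda>q. fib_add (tangent_bundle M) (fib_scale (tangent_bundle M) r0 (s0 q))
      (fib_scale (tangent_bundle M) r1 (s1 q))) v =
    fib_add (tangent_bundle M) (D (\<lambda>q. fib_scale (tangent_bundle M) r0 (s0 q)) v)
      (D (\<lambda>q. fib_scale (tangent_bundle M) r1 (s1 q)) v)"
    by (rule pointwise[OF smooth_section_scale[OF s(1)], THEN conjunct1, rule_format,
          OF smooth_section_scale[OF s(2)]])
  then show ?thesis
    using scale s by (simp add: tangent_bundle_def)
qed

lemma continuous_curvature_component: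
  assumes D: "connection M (tangent_bundle M) D0" "connection M (tangent_bundle M) D1"
    and U: "(U, \<phi>) \<in> M" "p \<in> U"
  shows "continuous_on T (\<lambda>t. components \<phi> (curvature M (tangent_bundle M)
      (conn_path (tangent_bundle M) D0 D1 t) (coord_field M U \<phi> a) (coord_field M U \<phi> b)
      (coord_field M U \<phi> j) p) $ i)"
proof -
  define f where "f = (\<lambda>q. \<phi> q $ i)"
  let ?s = "coord_field M U \<phi> j"
  let ?D = "\<lambda>t. conn_path (tangent_bundle M) D0 D1 t"
  have path: "snd (?D t s v) f = (1 - t) * snd (D0 s v) f + t * snd (D1 s v) f" for t s v
    by (simp add: conn_path_def tangent_bundle_def)
  \<comment> \<open>The outer derivative acts on a section that itself depends on t. Linearity
    splits it into four iterated derivatives independent of t; the Lie bracket term of the curvature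
    is just affine in t.\<close>
  have second: "snd (?D t (\<lambda>q. ?D t ?s (coord_field M U \<phi> k q)) (coord_field M U \<phi> l p)) f =
      (1 - t) * ((1 - t) * snd (D0 (\<lambda>q. D0 ?s (coord_field M U \<phi> k q)) (coord_field M U \<phi> l p)) f +
        t * snd (D0 (\<lambda>q. D1 ?s (coord_field M U \<phi> k q)) (coord_field M U \<phi> l p)) f) +
      t * ((1 - t) * snd (D1 (\<lambda>q. D0 ?s (coord_field M U \<phi> k q)) (coord_field M U \<phi> l p)) f +
        t * snd (D1 (\<lambda>q. D1 ?s (coord_field M U \<phi> k q)) (coord_field M U \<phi> l p)) f)" for t k l
  proof -
    \<comment> \<open>By the last clause of \<open>connection\<close>, differentiating a smooth
      section along a smooth field gives a smooth section again, so the outer connection may be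
      applied.\<close>
    have sm: "smooth_section M (tangent_bundle M) U (\<lambda>q. D0 ?s (coord_field M U \<phi> k q))"
      "smooth_section M (tangent_bundle M) U (\<lambda>q. D1 ?s (coord_field M U \<phi> k q))"
      using D[unfolded connection_def, THEN spec, THEN spec, THEN mp, THEN conjunct2, rule_format,
          OF smooth_coord_field[OF U(1)] smooth_coord_field[OF U(1)]] by this
    note lin = connection_linear[OF _ sm U(2) coord_field_in_fibre[OF U]]
    show ?thesis
      unfolding path using lin[OF D(1)] lin[OF D(2)] by (simp add: conn_path_def)
  qed
  have comp: "components \<phi> v $ i = snd v f" for v by (simp add: components_def f_def)
  have sub: "snd (fib_sub (tangent_bundle M) v w) f = snd v f - snd w f" for v w
    by (simp add: fib_sub_def tangent_bundle_def)
  show ?thesis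
    unfolding comp curvature_def sub second unfolding path by (intro continuous_intros)
qed

end

section \<open>Integration along the path of connections\<close>

lemma homogeneous_form1: "homogeneous 1 (form1 \<alpha>)"
  unfolding form1_def by (intro homogeneous_sum homogeneous_intros homogeneous_dx)

lemma homogeneous_form2: "homogeneous 2 (form2 \<beta>)"
proof -
  have "homogeneous 2 (dx a * dx b)" for a b :: "'a::{finite,linorder}"
    using homogeneous_mult[OF homogeneous_dx homogeneous_dx] by (simp add: numeral_2_eq_2)
  then show ?thesis
    unfolding form2_def by (intro homogeneous_intros(4) homogeneous_sum)
qed

lemma continuous_on_matrix_mult:
  fixes B C :: "'t::topological_space \<Rightarrow> 'a::real_normed_algebra_1^'k^'k"
  assumes "\<And>i j. continuous_on T (\<lambda>t. B t $ i $ j)" "\<And>i j. continuous_on T (\<lambda>t. C t $ i $ j)"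
  shows "continuous_on T (\<lambda>t. (B t ** C t) $ i $ j)"
  unfolding matrix_matrix_mult_def by (simp add: assms continuous_intros)

lemma continuous_on_matrix_power:
  fixes B :: "'t::topological_space \<Rightarrow> 'a::real_normed_algebra_1^'k^'k"
  assumes "\<And>i j. continuous_on T (\<lambda>t. B t $ i $ j)"
  shows "continuous_on T (\<lambda>t. matrix_power (B t) k $ i $ j)"
proof (induction k arbitrary: i j)
  case (Suc k)
  then show ?case
    unfolding matrix_power.simps using assms by (intro continuous_on_matrix_mult)
qed simp

lemma continuous_on_trace:
  fixes B :: "'t::topological_space \<Rightarrow> 'a::real_normed_algebra_1^'k^'k"
  assumes "\<And>i j. continuous_on T (\<lambda>t. B t $ i $ j)"
  shows "continuous_on T (\<lambda>t. trace (B t))"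
  unfolding trace_def by (intro continuous_on_sum assms)

context
  fixes R :: "'t::topological_space \<Rightarrow> 'n::{finite,linorder} exterior^'n::{finite,linorder}^'n::{finite,linorder}"
    and A :: "'n::{finite,linorder} exterior^'n::{finite,linorder}^'n::{finite,linorder}"
    and c :: "'n::{finite,linorder} exterior" and T :: "'t set"
  assumes dim: "CARD('n::{finite,linorder}) = 11"
    and R: "\<And>t i j. homogeneous 2 (R t $ i $ j)"
    and A: "\<And>i j. homogeneous 1 (A $ i $ j)"
    and c: "homogeneous 2 c"
    and cont: "\<And>i j. continuous_on T (\<lambda>t. R t $ i $ j)"
begin

section \<open>Continuity in the parameter of the factors of the integrands\<close>

lemma continuous_on_power_trace: "continuous_on T (\<lambda>t. power_trace (R t) k)"
  unfolding power_trace_def by (intro continuous_on_trace continuous_on_matrix_power cont)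

lemma continuous_on_transgression_trace: "continuous_on T (\<lambda>t. transgression_trace A (R t) k)"
  unfolding transgression_trace_def
  by (intro continuous_on_trace continuous_on_matrix_mult continuous_on_matrix_power cont) auto

lemma continuous_on_trace_mult: "continuous_on T (\<lambda>t. trace (A ** fps_matrix f (R t)))"
  unfolding trace_mult_fps_matrix[OF dim R A c]
  by (intro continuous_intros continuous_on_transgression_trace)

lemma continuous_on_chern_character: "continuous_on T (\<lambda>t. chern_character (R t))"
  unfolding chern_character_def trace_fps_matrix[OF dim R A c]
  by (intro continuous_intros continuous_on_power_trace)

text \<open>The decomposition into components exhibits the exponential of a trace of a series as a
  polynomial in two power traces, so no uniform convergence argument is required.\<close>

lemma continuous_on_L_hat: "continuous_on T (\<lambda>t. L_hat (R t))"
  using components4_L_hat[OF dim R A c] unfolding components4_def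
  by (simp add: continuous_intros continuous_on_power_trace)

lemma continuous_on_A_hat: "continuous_on T (\<lambda>t. A_hat (R t))"
  using components4_A_hat[OF dim R A c] unfolding components4_def
  by (simp add: continuous_intros continuous_on_power_trace)

end

lemma integral_degree_11_identity:
  fixes R :: "real \<Rightarrow> 'n::{finite,linorder} exterior^'n::{finite,linorder}^'n::{finite,linorder}"
    and A :: "'n::{finite,linorder} exterior^'n::{finite,linorder}^'n::{finite,linorder}"
    and c :: "'n::{finite,linorder} exterior"
  assumes dim: "CARD('n::{finite,linorder}) = 11"
    and R: "\<And>t i j. homogeneous 2 (R t $ i $ j)"
    and A: "\<And>i j. homogeneous 1 (A $ i $ j)"
    and c: "homogeneous 2 c"
    and cont: "\<And>i j. continuous_on {0..1} (\<lambda>t. R t $ i $ j)"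
  shows "degree_part 11
      (integral {0..1} (\<lambda>t.
         sqrt 2 *\<^sub>R L_hat (R t) * fps_form (inverse (fps_cosh (1/2) ^ 2)) c *
         trace (A ** fps_matrix sin_series (R t))))
    = 8 *\<^sub>R degree_part 11
      (integral {0..1} (\<lambda>t.
         A_hat (R t) * cosh (c /\<^sub>R 2) *
         (chern_character (R t) - 3 * (exp c + exp (- c) - 2)) *
         trace (A ** fps_matrix tan_series (R t))) +
       integral {0..1} (\<lambda>t.
         A_hat (R t) * cosh (c /\<^sub>R 2) *
         trace (A ** fps_matrix
           (- fps_const (1 / (2 * pi)) * fps_sin (1 / (2 * pi)) - 3 * tan_series) (R t))))"
    (is "degree_part 11 (integral _ ?f) = 8 *\<^sub>R degree_part 11 (integral _ ?g + integral _ ?h)")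
proof -
  note intros = continuous_on_L_hat[OF dim R A c cont] continuous_on_A_hat[OF dim R A c cont]
    continuous_on_chern_character[OF dim R A c cont] continuous_on_trace_mult[OF dim R A c cont]
  have int: "?f integrable_on {0..1}" "?g integrable_on {0..1}" "?h integrable_on {0..1}"
    by (intro integrable_continuous_interval continuous_intros intros)+
  \<comment> \<open>Taking a homogeneous component is bounded linear and so commutes with the
    integral; this carries the pointwise identity over to the integrals.\<close>
  have degree: "degree_part 11 (integral {0..1} F) = integral {0..1} (\<lambda>t. degree_part 11 (F t))"
    if "F integrable_on {0..1}" for F :: "real \<Rightarrow> 'n exterior"
    using integral_linear[OF that bounded_linear_degree_part] by (simp add: o_def)
  have "integral {0..1} (\<lambda>t. degree_part 11 (?f t)) =
      integral {0..1} (\<lambda>t. 8 *\<^sub>R degree_part 11 (?g t + ?h t))"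
    by (simp only: degree_11_identity[OF dim R A c])
  also have "\<dots> = 8 *\<^sub>R degree_part 11 (integral {0..1} (\<lambda>t. ?g t + ?h t))"
    using integrable_add[OF int(2,3)] by (simp add: degree)
  also have "integral {0..1} (\<lambda>t. ?g t + ?h t) = integral {0..1} ?g + integral {0..1} ?h"
    by (rule Henstock_Kurzweil_Integration.integral_add[OF int(2,3)])
  finally show ?thesis
    by (simp only: degree[OF int(1)])
qed

theorem corollary3p3:
  fixes M :: "('m::{t2_space,second_countable_topology}, 11) atlas"
    and g :: "'m tvec \<Rightarrow> 'm tvec \<Rightarrow> real"
    and D0 D1 :: "('m, 'm tvec) conn"
    and \<xi> :: "('m, 'e, 2) vbundle"
    and h :: "'e \<Rightarrow> 'e \<Rightarrow> real"
    and ori :: "'e \<Rightarrow> 'e \<Rightarrow> bool"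
    and D\<xi> :: "('m, 'e) conn"
    and U :: "'m set" and \<phi> :: "'m \<Rightarrow> real^11" and p :: 'm
  assumes "smooth_manifold M"
    and "bundle_metric M (tangent_bundle M) g"
    and "connection M (tangent_bundle M) D0"
    and "connection M (tangent_bundle M) D1"
    and "vector_bundle M \<xi>"
    and "bundle_metric M \<xi> h"
    and "orientation \<xi> ori"
    and "euclidean_connection M \<xi> h D\<xi>"
    and "(U, \<phi>) \<in> M" and "p \<in> U"
  shows
    "let A = difference_matrix M U \<phi> p D1 D0;
         R = (\<lambda>t. curvature_matrix M U \<phi> p (conn_path (tangent_bundle M) D0 D1 t));
         c = euler_form_in_chart M U \<phi> p \<xi> h ori D\<xi>
     in degree_part 11
          (integral {0..1} (\<lambda>t.
             sqrt 2 *\<^sub>R L_hat (R t) * fps_form (inverse (fps_cosh (1/2) ^ 2)) c *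
             trace (A ** fps_matrix sin_series (R t))))
      = 8 *\<^sub>R degree_part 11
          (integral {0..1} (\<lambda>t.
             A_hat (R t) * cosh (c /\<^sub>R 2) *
             (chern_character (R t) - 3 * (exp c + exp (- c) - 2)) *
             trace (A ** fps_matrix tan_series (R t))) +
           integral {0..1} (\<lambda>t.
             A_hat (R t) * cosh (c /\<^sub>R 2) *
             trace (A ** fps_matrix
               (- fps_const (1 / (2 * pi)) * fps_sin (1 / (2 * pi)) - 3 * tan_series) (R t))))"
proof -
  define A where "A = difference_matrix M U \<phi> p D1 D0"
  define R where "R = (\<lambda>t. curvature_matrix M U \<phi> p (conn_path (tangent_bundle M) D0 D1 t))"
  define c where "c = euler_form_in_chart M U \<phi> p \<xi> h ori D\<xi>"
  have "homogeneous 2 (R t $ i $ j)" for t i j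
    by (simp add: R_def curvature_matrix_def homogeneous_form2)
  moreover have "homogeneous 1 (A $ i $ j)" for i j
    unfolding A_def difference_matrix_def vec_lambda_beta by (rule homogeneous_form1)
  moreover have "homogeneous 2 c"
    by (simp add: c_def euler_form_in_chart_def homogeneous_form2)
  moreover have "continuous_on {0..1} (\<lambda>t. R t $ i $ j)" for i j
    unfolding R_def curvature_matrix_def form2_def vec_lambda_beta
    by (intro continuous_intros continuous_curvature_component assms)
  ultimately show ?thesis
    unfolding Let_def A_def[symmetric] R_def[symmetric] c_def[symmetric]
    using integral_degree_11_identity[of R A c] by (simp add: R_def)
qed

end
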